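(* Let $D$ be a non-commutative division ring with center $F$ which is algebraic over $F$ and weakly locally finite, let $n\ge1$, and let $N$ be a subgroup of $\mathrm{GL}_n(D)$ containing $F^*I=\{\alpha I\mid\alpha\in F^*\}$. Then $N$ is not finitely generated.
   Context: A division ring $D$ is weakly locally finite if for every finite subset $S\subseteq D$, the division subring generated by $S$ is finite dimensional over its own center. $D$ is algebraic over $F$ if every element is algebraic over $F$. $I$ is the identity matrix. *)

theory Defs
  imports "HOL-Analysis.Analysis" "HOL-Algebra.Generated_Groups"
begin

(* Center of a (possibly non-commutative) ring *)
definition center :: "'a::ring_1 set" where
  "center = {z. \<forall>y. z * y = y * z}"

(* x is algebraic over the subset F: root of a nonzero polynomial with coefficients in F
   (written out as a finite sum, coefficients placed on the left) *)
definition algebraic_over :: "'a::ring_1 set \<Rightarrow> 'a \<Rightarrow> bool" where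
  "algebraic_over F x \<longleftrightarrow>
     (\<exists>(m::nat) c. (\<forall>i\<le>m. c i \<in> F) \<and> (\<exists>i\<le>m. c i \<noteq> 0) \<and> (\<Sum>i\<le>m. c i * x ^ i) = 0)"

(* division subring generated by a set S *)
inductive_set div_subring_gen :: "'a::division_ring set \<Rightarrow> 'a set" for S where
  gen: "x \<in> S \<Longrightarrow> x \<in> div_subring_gen S"
| zero: "0 \<in> div_subring_gen S"
| one: "1 \<in> div_subring_gen S"
| add: "x \<in> div_subring_gen S \<Longrightarrow> y \<in> div_subring_gen S \<Longrightarrow> x + y \<in> div_subring_gen S"
| neg: "x \<in> div_subring_gen S \<Longrightarrow> - x \<in> div_subring_gen S"
| mult: "x \<in> div_subring_gen S \<Longrightarrow> y \<in> div_subring_gen S \<Longrightarrow> x * y \<in> div_subring_gen S"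
| inv: "x \<in> div_subring_gen S \<Longrightarrow> inverse x \<in> div_subring_gen S"

(* center of a subring K *)
definition center_of :: "'a::ring_1 set \<Rightarrow> 'a set" where
  "center_of K = {z \<in> K. \<forall>y\<in>K. z * y = y * z}"

(* K is finite dimensional as a (left) vector space over the subfield Z \<subseteq> K *)
definition fin_dim_over :: "'a::ring_1 set \<Rightarrow> 'a set \<Rightarrow> bool" where
  "fin_dim_over Z K \<longleftrightarrow>
     (\<exists>B. finite B \<and> B \<subseteq> K \<and>
        (\<forall>x\<in>K. \<exists>c. (\<forall>b\<in>B. c b \<in> Z) \<and> x = (\<Sum>b\<in>B. c b * b)))"

definition weakly_locally_finite :: "'a::division_ring itself \<Rightarrow> bool" where
  "weakly_locally_finite _ \<longleftrightarrow>
     (\<forall>S::'a set. finite S \<longrightarrow>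
        fin_dim_over (center_of (div_subring_gen S)) (div_subring_gen S))"

(* GL_n(D) as a monoid (group) structure: invertible n x n matrices *)
definition GL :: "('a::division_ring ^'n ^'n) monoid" where
  "GL = \<lparr>carrier = {A. invertible A}, mult = (**), one = mat 1\<rparr>"

end

theory Submission
  imports Defs
begin

text \<open>Suppose \<open>N\<close> is generated by finitely many matrices, and let \<open>K\<close> be the ring generated by the
  entries of the generators and of their inverses. Since \<open>F\<^sup>*I \<subseteq> N\<close>, the ring \<open>K\<close> contains \<open>F\<close>, and as \<open>D\<close>
  is algebraic over \<open>F\<close> it is a division ring; by weak local finiteness it is finite dimensional over
  its center \<open>Z\<close>. An Artin--Tate argument shows that the field \<open>Z\<close> is finitely generated as a ring,
  hence finite (Zariski's lemma over the integers). So \<open>F \<subseteq> Z\<close> is finite, and \<open>D\<close>, being algebraic over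
  a finite field, is commutative by Jacobson's theorem, a contradiction.\<close>

subsection \<open>Generated rings and spans\<close>

text \<open>The ring generated by the entries and the division ring generated by them must coincide:
  finite generation concerns the former, weak local finiteness the latter, and algebraicity is the
  bridge. Zariski's lemma has to start from the integers, so it is run over an arbitrary subring
  \<open>R\<close> of a field. Removing one generator costs one denominator \<open>s\<close>, and
  what is carried down is that every nonzero element of \<open>R\<close> becomes invertible in
  \<open>R[1/s]\<close>; for the integers this is absurd. For Jacobson's theorem, a torsion element
  \<open>a\<close> that is not central yields \<open>x\<close> with \<open>x * a = a ^ j * x\<close>
  and \<open>a ^ j \<noteq> a\<close>. Conjugation by \<open>x\<close> acts on a finite field
  containing \<open>a\<close>, and the powers of \<open>x\<close> span a cyclic algebra over it. As
  norms of finite fields are surjective, \<open>x\<close> can be rescaled so that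
  \<open>x ^ k = 1\<close>; the factorization of \<open>x ^ k - 1\<close> then gives a linear
  relation between powers of \<open>x\<close>, which is impossible unless
  \<open>k = 1\<close>.\<close>

inductive_set ring_gen :: "'a::ring_1 set \<Rightarrow> 'a set" for S where
  gen: "x \<in> S \<Longrightarrow> x \<in> ring_gen S"
| one: "1 \<in> ring_gen S"
| diff: "x \<in> ring_gen S \<Longrightarrow> y \<in> ring_gen S \<Longrightarrow> x - y \<in> ring_gen S"
| mult: "x \<in> ring_gen S \<Longrightarrow> y \<in> ring_gen S \<Longrightarrow> x * y \<in> ring_gen S"

definition subring_set :: "'a::ring_1 set \<Rightarrow> bool" where
  "subring_set R \<longleftrightarrow> 1 \<in> R \<and> (\<forall>x\<in>R. \<forall>y\<in>R. x - y \<in> R) \<and> (\<forall>x\<in>R. \<forall>y\<in>R. x * y \<in> R)"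

lemma subring_setD:
  assumes "subring_set R"
  shows "0 \<in> R" "1 \<in> R"
    and "x \<in> R \<Longrightarrow> y \<in> R \<Longrightarrow> x - y \<in> R"
    and "x \<in> R \<Longrightarrow> y \<in> R \<Longrightarrow> x * y \<in> R"
    and "x \<in> R \<Longrightarrow> - x \<in> R"
    and "x \<in> R \<Longrightarrow> y \<in> R \<Longrightarrow> x + y \<in> R"
    and "x \<in> R \<Longrightarrow> x ^ n \<in> R"
proof -
  have d: "x - y \<in> R" if "x \<in> R" "y \<in> R" for x y
    using assms that by (auto simp: subring_set_def)
  show one: "1 \<in> R" and m: "x \<in> R \<Longrightarrow> y \<in> R \<Longrightarrow> x * y \<in> R" for x y
    using assms by (auto simp: subring_set_def)
  show z: "0 \<in> R" using d[OF one one] by simp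
  show "x \<in> R \<Longrightarrow> y \<in> R \<Longrightarrow> x - y \<in> R" by (rule d)
  show n: "x \<in> R \<Longrightarrow> - x \<in> R" for x using d[OF z] by fastforce
  show "x \<in> R \<Longrightarrow> y \<in> R \<Longrightarrow> x + y \<in> R" using d[OF _ n, of x y] by simp
  show "x \<in> R \<Longrightarrow> x ^ n \<in> R" by (induction n) (auto intro: one m)
qed

lemma subring_set_sum:
  assumes "subring_set R" "\<And>i. i \<in> I \<Longrightarrow> f i \<in> R"
  shows "sum f I \<in> R"
  using assms(2) by (induction I rule: infinite_finite_induct) (auto intro: subring_setD[OF assms(1)])

lemma subring_set_ring_gen: "subring_set (ring_gen S)"
  by (auto simp: subring_set_def intro: ring_gen.intros)

lemma ring_gen_least:
  assumes "subring_set R" "S \<subseteq> R"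
  shows "ring_gen S \<subseteq> R"
proof
  fix x assume "x \<in> ring_gen S"
  then show "x \<in> R"
    by induction (use assms in \<open>auto intro: subring_setD[OF assms(1)]\<close>)
qed

lemma ring_gen_mono: "S \<subseteq> T \<Longrightarrow> ring_gen S \<subseteq> ring_gen T"
  by (rule ring_gen_least[OF subring_set_ring_gen]) (auto intro: ring_gen.gen)

lemma ring_gen_Un_ring_gen:
  "ring_gen (ring_gen S \<union> T) = ring_gen (S \<union> T)"
proof
  have "ring_gen S \<subseteq> ring_gen (S \<union> T)" by (rule ring_gen_mono) auto
  then show "ring_gen (ring_gen S \<union> T) \<subseteq> ring_gen (S \<union> T)"
    by (intro ring_gen_least subring_set_ring_gen) (auto intro: ring_gen.gen)
  show "ring_gen (S \<union> T) \<subseteq> ring_gen (ring_gen S \<union> T)"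
    by (rule ring_gen_mono) (auto intro: ring_gen.gen)
qed

lemma ring_gen_commute_elem:
  assumes "\<And>y. y \<in> S \<Longrightarrow> x * y = y * x" and "u \<in> ring_gen S"
  shows "x * u = u * x"
  using assms(2)
proof induction
  case (mult u v)
  then show ?case by (metis mult.assoc)
qed (use assms(1) in \<open>auto simp: algebra_simps\<close>)

lemma ring_gen_commute:
  assumes "\<And>x y. x \<in> S \<Longrightarrow> y \<in> S \<Longrightarrow> x * y = y * x"
    and "u \<in> ring_gen S" "v \<in> ring_gen S"
  shows "u * v = v * u"
proof (rule ring_gen_commute_elem[OF _ assms(3)])
  fix y assume "y \<in> S"
  then have "y * u = u * y" by (intro ring_gen_commute_elem[OF _ assms(2)] assms(1))
  then show "u * y = y * u" by simp
qed

definition span_over :: "'a::ring_1 set \<Rightarrow> 'a set \<Rightarrow> 'a set" where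
  "span_over A B = {\<Sum>b\<in>B. c b * b | c. \<forall>b\<in>B. c b \<in> A}"

lemma finite_span_over:
  assumes "finite A" "finite B"
  shows "finite (span_over A B)"
proof (rule finite_subset)
  show "span_over A B \<subseteq> (\<lambda>c. \<Sum>b\<in>B. c b * b) ` (B \<rightarrow>\<^sub>E A)"
  proof
    fix x assume "x \<in> span_over A B"
    then obtain c where c: "\<forall>b\<in>B. c b \<in> A" "x = (\<Sum>b\<in>B. c b * b)"
      by (auto simp: span_over_def)
    then show "x \<in> (\<lambda>c. \<Sum>b\<in>B. c b * b) ` (B \<rightarrow>\<^sub>E A)"
      by (intro image_eqI[of _ _ "restrict c B"]) auto
  qed
  show "finite ((\<lambda>c. \<Sum>b\<in>B. c b * b) ` (B \<rightarrow>\<^sub>E A))"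
    using assms by (intro finite_imageI finite_PiE) auto
qed

lemma span_over_scaled_base:
  assumes "finite B" "0 \<in> A" "b \<in> B" "c \<in> A"
  shows "c * b \<in> span_over A B"
  unfolding span_over_def
proof (intro CollectI exI[of _ "\<lambda>x. if x = b then c else 0"] conjI)
  have "(\<Sum>x\<in>B. (if x = b then c else 0) * x) = (\<Sum>x\<in>B. if x = b then c * b else 0)"
    by (rule sum.cong) auto
  then show "c * b = (\<Sum>x\<in>B. (if x = b then c else 0) * x)"
    using assms by simp
qed (use assms in auto)

lemma span_over_zero: "0 \<in> A \<Longrightarrow> 0 \<in> span_over A B"
  unfolding span_over_def by (rule CollectI, rule exI[of _ "\<lambda>_. 0"]) auto

lemma span_over_add:
  assumes "\<And>x y. x \<in> A \<Longrightarrow> y \<in> A \<Longrightarrow> x + y \<in> A"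
    and "x \<in> span_over A B" "y \<in> span_over A B"
  shows "x + y \<in> span_over A B"
proof -
  from assms(2,3) obtain c d where
    "\<forall>b\<in>B. c b \<in> A" "x = (\<Sum>b\<in>B. c b * b)" "\<forall>b\<in>B. d b \<in> A" "y = (\<Sum>b\<in>B. d b * b)"
    by (auto simp: span_over_def)
  then have "x + y = (\<Sum>b\<in>B. (c b + d b) * b)" "\<forall>b\<in>B. c b + d b \<in> A"
    using assms(1) by (auto simp: sum.distrib algebra_simps)
  then show ?thesis unfolding span_over_def
    by (intro CollectI exI[of _ "\<lambda>b. c b + d b"]) auto
qed

lemma span_over_scale:
  assumes "\<And>x y. x \<in> A \<Longrightarrow> y \<in> A \<Longrightarrow> x * y \<in> A" and "a \<in> A" "x \<in> span_over A B"
  shows "a * x \<in> span_over A B"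
proof -
  from assms(3) obtain c where "\<forall>b\<in>B. c b \<in> A" "x = (\<Sum>b\<in>B. c b * b)"
    by (auto simp: span_over_def)
  then have "a * x = (\<Sum>b\<in>B. (a * c b) * b)" "\<forall>b\<in>B. a * c b \<in> A"
    using assms(1,2) by (auto simp: sum_distrib_left mult.assoc)
  then show ?thesis unfolding span_over_def
    by (intro CollectI exI[of _ "\<lambda>b. a * c b"]) auto
qed

text \<open>Used with sets such as \<open>{u. u * y \<in> W}\<close>: claims about products of spans
  reduce to products of spanning elements, one factor at a time.\<close>

lemma span_over_least:
  assumes "0 \<in> X" "\<And>x y. x \<in> X \<Longrightarrow> y \<in> X \<Longrightarrow> x + y \<in> X"
    and "\<And>c b. c \<in> A \<Longrightarrow> b \<in> B \<Longrightarrow> c * b \<in> X"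
  shows "span_over A B \<subseteq> X"
proof
  fix x assume "x \<in> span_over A B"
  then obtain c where c: "\<forall>b\<in>B. c b \<in> A" "x = (\<Sum>b\<in>B. c b * b)"
    by (auto simp: span_over_def)
  have "(\<Sum>b\<in>C. c b * b) \<in> X" if "C \<subseteq> B" for C
    using that by (induction C rule: infinite_finite_induct) (use assms c in auto)
  then show "x \<in> X" using c by simp
qed

lemma span_over_sum:
  assumes "subring_set A" "\<And>i. i \<in> I \<Longrightarrow> f i \<in> span_over A B"
  shows "sum f I \<in> span_over A B"
  using assms(2)
  by (induction I rule: infinite_finite_induct)
    (auto intro!: span_over_zero span_over_add subring_setD[OF assms(1)])

subsection \<open>Fields that are finitely generated as rings\<close>

text \<open>Polynomials over the subring \<open>R\<close> live in the polynomial type of the ambient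
  ring, since \<open>R\<close> is a set and not a type.\<close>

definition coeffs_in :: "'a::zero set \<Rightarrow> 'a poly \<Rightarrow> bool" where
  "coeffs_in R p \<longleftrightarrow> (\<forall>i. coeff p i \<in> R)"

lemma coeffs_in_closed:
  fixes R :: "'a::comm_ring_1 set"
  assumes R: "subring_set R"
  shows "coeffs_in R 0" "coeffs_in R 1" "c \<in> R \<Longrightarrow> coeffs_in R [:c:]"
    and "c \<in> R \<Longrightarrow> coeffs_in R (monom c n)"
    and "coeffs_in R p \<Longrightarrow> coeffs_in R q \<Longrightarrow> coeffs_in R (p + q)"
    and "coeffs_in R p \<Longrightarrow> coeffs_in R q \<Longrightarrow> coeffs_in R (p - q)"
    and "coeffs_in R p \<Longrightarrow> coeffs_in R q \<Longrightarrow> coeffs_in R (p * q)"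
    and "coeffs_in R p \<Longrightarrow> c \<in> R \<Longrightarrow> coeffs_in R (smult c p)"
    and "coeffs_in R p \<Longrightarrow> coeffs_in R (p ^ n)"
proof -
  note RD = subring_setD[OF R]
  show 1: "coeffs_in R 1" and "coeffs_in R 0"
    using RD(1,2) by (auto simp: coeffs_in_def coeff_1)
  show "c \<in> R \<Longrightarrow> coeffs_in R [:c:]"
    using RD(1) by (auto simp: coeffs_in_def coeff_pCons split: nat.splits)
  show "c \<in> R \<Longrightarrow> coeffs_in R (monom c n)"
    using RD(1) by (auto simp: coeffs_in_def)
  show "coeffs_in R p \<Longrightarrow> coeffs_in R q \<Longrightarrow> coeffs_in R (p + q)"
    and "coeffs_in R p \<Longrightarrow> coeffs_in R q \<Longrightarrow> coeffs_in R (p - q)"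
    and "coeffs_in R p \<Longrightarrow> c \<in> R \<Longrightarrow> coeffs_in R (smult c p)"
    by (auto simp: coeffs_in_def intro: RD)
  show m: "coeffs_in R p \<Longrightarrow> coeffs_in R q \<Longrightarrow> coeffs_in R (p * q)" for p q
    by (auto simp: coeffs_in_def coeff_mult intro!: subring_set_sum[OF R] RD)
  show "coeffs_in R p \<Longrightarrow> coeffs_in R (p ^ n)"
    by (induction n) (auto intro: 1 m)
qed

lemma poly_in_subring:
  assumes "subring_set R" "coeffs_in R p" "x \<in> R"
  shows "poly p x \<in> R"
  using assms(2)
  by (auto simp: poly_altdef coeffs_in_def intro!: subring_set_sum[OF assms(1)] subring_setD[OF assms(1)] assms(3))

lemma ring_gen_insert_eq_poly:
  fixes R :: "'a::comm_ring_1 set"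
  assumes R: "subring_set R"
  shows "ring_gen (insert a R) = {poly p a | p. coeffs_in R p}"
proof
  note cl = coeffs_in_closed[OF R]
  have "subring_set {poly p a | p. coeffs_in R p}"
    unfolding subring_set_def
  proof (intro conjI ballI)
    show "1 \<in> {poly p a | p. coeffs_in R p}" using cl(2) by (metis (mono_tags, lifting) CollectI poly_1)
  qed (auto, metis cl(6) poly_diff, metis cl(7) poly_mult)
  moreover have "x \<in> {poly p a | p. coeffs_in R p}" if "x \<in> R" for x
    using cl(3)[OF that] by (intro CollectI exI[of _ "[:x:]"]) auto
  moreover have "a \<in> {poly p a | p. coeffs_in R p}"
    using cl(4)[of 1 1] subring_setD(2)[OF R] by (intro CollectI exI[of _ "monom 1 1"]) (auto simp: poly_monom)
  ultimately show "ring_gen (insert a R) \<subseteq> {poly p a | p. coeffs_in R p}"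
    by (intro ring_gen_least) auto
  show "{poly p a | p. coeffs_in R p} \<subseteq> ring_gen (insert a R)"
  proof safe
    fix p assume "coeffs_in R p"
    then have "coeffs_in (ring_gen (insert a R)) p" by (auto simp: coeffs_in_def intro: ring_gen.gen)
    then show "poly p a \<in> ring_gen (insert a R)"
      by (intro poly_in_subring subring_set_ring_gen) (auto intro: ring_gen.gen)
  qed
qed

text \<open>Leading coefficients need not be invertible in \<open>R\<close>, so each cancellation of
  the top term of \<open>f\<close> first multiplies \<open>f\<close> by the leading coefficient of
  \<open>g\<close>; \<open>k\<close> counts these multiplications.\<close>

lemma pseudo_division_in_subring:
  fixes R :: "'a::idom set"
  assumes R: "subring_set R" and g: "coeffs_in R g" "degree g > 0" and f: "coeffs_in R f"
  shows "\<exists>k q r. coeffs_in R q \<and> coeffs_in R r \<and> degree r < degree g \<and>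
           smult (lead_coeff g ^ k) f = g * q + r"
  using f
proof (induction "degree f" arbitrary: f rule: less_induct)
  case less
  note cl = coeffs_in_closed[OF R]
  show ?case
  proof (cases "degree f < degree g")
    case True
    then show ?thesis
      by (intro exI[of _ 0] exI[of _ "0::'a poly"] exI[of _ f]) (use less.prems cl in auto)
  next
    case False
    define t where "t = monom (lead_coeff f) (degree f - degree g)"
    have t: "coeffs_in R t" unfolding t_def using less.prems by (intro cl) (auto simp: coeffs_in_def)
    define f' where "f' = smult (lead_coeff g) f - g * t"
    have f': "coeffs_in R f'" unfolding f'_def
      by (intro cl t g less.prems) (use g in \<open>auto simp: coeffs_in_def\<close>)
    have g0: "g \<noteq> 0" and f0: "f \<noteq> 0" using g False by auto
    have t0: "t \<noteq> 0" "degree t = degree f - degree g"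
      using f0 by (auto simp: t_def degree_monom_eq)
    have "degree f' < degree f"
    proof (rule ccontr)
      assume "\<not> degree f' < degree f"
      moreover have "degree f' \<le> degree f" unfolding f'_def
        using False t0 g0 by (intro degree_diff_le) (auto simp: degree_mult_eq)
      ultimately have eq: "degree f' = degree f" by simp
      have "coeff (g * t) (degree f) = lead_coeff g * lead_coeff f"
        using coeff_degree_mult[of g t] t0 g0 False by (simp add: degree_mult_eq t_def lead_coeff_monom)
      then have "coeff f' (degree f) = 0" by (simp add: f'_def)
      then have "f' = 0" using eq by (metis leading_coeff_0_iff)
      then show False using eq False g by simp
    qed
    from less.hyps[OF this f'] obtain k q r where
      IH: "coeffs_in R q" "coeffs_in R r" "degree r < degree g" "smult (lead_coeff g ^ k) f' = g * q + r"
      by blast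
    have "smult (lead_coeff g ^ Suc k) f = g * (q + smult (lead_coeff g ^ k) t) + r"
      using IH(4) by (simp add: f'_def smult_diff_right algebra_simps)
    moreover have "coeffs_in R (q + smult (lead_coeff g ^ k) t)"
      using g IH t by (intro cl) (auto simp: coeffs_in_def intro: subring_setD[OF R])
    ultimately show ?thesis using IH by blast
  qed
qed

text \<open>The Euclidean algorithm with denominators. Dividing \<open>p\<close> by \<open>g\<close>
  leaves \<open>poly r a = - (poly g a * poly q a)\<close>, so an inverse of \<open>poly r a\<close>
  up to a factor in \<open>R\<close> yields one for \<open>poly g a\<close>. Minimality of
  \<open>degree p\<close> replaces irreducibility: if \<open>r = 0\<close>, then \<open>q\<close>
  would annihilate \<open>a\<close> in smaller degree.\<close>

lemma minimal_annihilator_inverse: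
  fixes R :: "'a::idom set"
  assumes R: "subring_set R" and p: "coeffs_in R p" "p \<noteq> 0" "poly p a = 0"
    and min: "\<And>q. coeffs_in R q \<Longrightarrow> q \<noteq> 0 \<Longrightarrow> poly q a = 0 \<Longrightarrow> degree p \<le> degree q"
    and g: "coeffs_in R g" "g \<noteq> 0" "degree g < degree p"
  shows "\<exists>h. coeffs_in R h \<and> poly g a * poly h a \<in> R - {0}"
  using g
proof (induction "degree g" arbitrary: g rule: less_induct)
  case less
  note cl = coeffs_in_closed[OF R]
  show ?case
  proof (cases "degree g = 0")
    case True
    then obtain c where "g = [:c:]" by (meson degree_eq_zeroE)
    moreover have "c \<in> R" using less.prems(1) calculation
      by (metis coeff_pCons_0 coeffs_in_def)
    ultimately show ?thesis using less.prems cl(2) by (intro exI[of _ 1]) auto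
  next
    case False
    then obtain k q r where qr: "coeffs_in R q" "coeffs_in R r" "degree r < degree g"
      "smult (lead_coeff g ^ k) p = g * q + r"
      using pseudo_division_in_subring[OF R less.prems(1) _ p(1)] by auto
    have ga: "poly g a \<noteq> 0" using min less.prems by force
    have eq: "poly g a * poly q a + poly r a = 0"
      using arg_cong[OF qr(4), of "\<lambda>u. poly u a"] p(3) by simp
    have "r \<noteq> 0"
    proof
      assume r: "r = 0"
      then have "poly q a = 0" using eq ga by simp
      have "q \<noteq> 0" using qr(4) r p(2) less.prems(2) by auto
      then have "degree p = degree g + degree q"
        using arg_cong[OF qr(4), of degree] r less.prems(2) by (simp add: degree_mult_eq)
      then show False using min[OF qr(1) \<open>q \<noteq> 0\<close> \<open>poly q a = 0\<close>] False by simp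
    qed
    then obtain h where h: "coeffs_in R h" "poly r a * poly h a \<in> R - {0}"
      using less.hyps[OF qr(3,2)] qr(3) less.prems(3) by auto
    have "poly g a * poly (0 - q * h) a = poly r a * poly h a"
    proof -
      have "poly r a = - (poly g a * poly q a)" using eq by (simp add: eq_neg_iff_add_eq_0 add.commute)
      then show ?thesis by simp
    qed
    then show ?thesis using h qr(1) cl(1,6,7) by metis
  qed
qed

section \<open>Localization at one element and removal of one ring generator\<close>

definition localize :: "'a::field set \<Rightarrow> 'a \<Rightarrow> 'a set" where
  "localize R s = {r / s ^ k | r k. r \<in> R}"

lemma localizeI: "r \<in> R \<Longrightarrow> r / s ^ k \<in> localize R s"
  by (auto simp: localize_def)

lemma subring_set_localize:
  assumes R: "subring_set R" and s: "s \<in> R" "s \<noteq> 0"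
  shows "subring_set (localize R s)"
  unfolding subring_set_def
proof (intro conjI ballI)
  note RD = subring_setD[OF R]
  show "1 \<in> localize R s" using localizeI[of 1 R s 0] RD by simp
  fix x y assume "x \<in> localize R s" "y \<in> localize R s"
  then obtain r k r' k' where e: "x = r / s ^ k" "y = r' / s ^ k'" "r \<in> R" "r' \<in> R"
    by (auto simp: localize_def)
  have "x - y = (r * s ^ k' - r' * s ^ k) / s ^ (k + k')" "x * y = (r * r') / s ^ (k + k')"
    using s by (auto simp: e field_simps power_add)
  then show "x - y \<in> localize R s" "x * y \<in> localize R s"
    using e s by (simp_all only:) (intro localizeI RD; assumption)+
qed

text \<open>For a transcendental \<open>a\<close>, no localization of \<open>R[a]\<close> at one element \<open>s'\<close> is a field, since
  \<open>1 + a s'\<close> stays a non-unit. So \<open>a\<close> is algebraic, and the denominators occurring in its equation and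
  in \<open>1 / s'\<close> are collected in \<open>s\<close>.\<close>

lemma localized_field_adjoin_algebraic:
  fixes R :: "'a::field set"
  assumes R: "subring_set R" and s': "s' \<in> ring_gen (insert a R)" "s' \<noteq> 0"
    and inv: "\<And>r. r \<in> ring_gen (insert a R) \<Longrightarrow> r \<noteq> 0 \<Longrightarrow> 1 / r \<in> localize (ring_gen (insert a R)) s'"
  shows "\<exists>p. coeffs_in R p \<and> p \<noteq> 0 \<and> poly p a = 0"
proof (rule ccontr)
  assume "\<not> ?thesis"
  then have tr: "p = 0" if "coeffs_in R p" "poly p a = 0" for p using that by auto
  note cl = coeffs_in_closed[OF R] and R1 = ring_gen_insert_eq_poly[OF R, of a]
  obtain g where g: "coeffs_in R g" "s' = poly g a" using s'(1) R1 by auto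
  define u where "u = 1 + monom 1 1 * g"
  have u: "coeffs_in R u" unfolding u_def using g cl subring_setD(2)[OF R] by simp
  have g0: "g \<noteq> 0" using g s' by auto
  have xg: "degree (monom 1 1 * g) = Suc (degree g)"
    using g0 by (subst degree_mult_eq) (auto simp: degree_monom_eq)
  have du: "degree u > 0" unfolding u_def using xg by (subst degree_add_eq_right) auto
  then have "poly u a \<noteq> 0" using tr[OF u] by auto
  moreover have "poly u a \<in> ring_gen (insert a R)" using u R1 by auto
  ultimately obtain q k where q: "1 / poly u a = q / s' ^ k" "q \<in> ring_gen (insert a R)"
    using inv[of "poly u a"] by (auto simp: localize_def)
  then obtain h where h: "coeffs_in R h" "q = poly h a" using R1 by auto
  have "poly (g ^ k - h * u) a = 0"
    using q h g s' \<open>poly u a \<noteq> 0\<close> by (simp add: field_simps)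
  then have "g ^ k - h * u = 0" using g h u by (intro tr cl)
  then have "u dvd g ^ k" by simp
  \<comment> \<open>\<open>u\<close> is \<open>1\<close> modulo \<open>g\<close>, hence prime to
    every power of \<open>g\<close>: if it divides \<open>g ^ Suc n\<close>, it also divides
    \<open>u * g ^ n - monom 1 1 * g ^ Suc n\<close>, which is \<open>g ^ n\<close>.\<close>
  moreover have "u dvd g ^ n \<Longrightarrow> is_unit u" for n
  proof (induction n)
    case (Suc n)
    have "u dvd u * g ^ n - monom 1 1 * g ^ Suc n" using Suc.prems by (intro dvd_diff) auto
    also have "u * g ^ n - monom 1 1 * g ^ Suc n = g ^ n" by (simp add: u_def algebra_simps)
    finally show ?case by (rule Suc.IH)
  qed simp
  ultimately have "is_unit u" by blast
  moreover have "u \<noteq> 0" using du by auto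
  ultimately show False using du by (simp add: is_unit_iff_degree)
qed

text \<open>The last clause of the conclusion is the hypothesis \<open>inv\<close> one level lower,
  with \<open>R\<close> in place of \<open>R[a]\<close>; this lets the lemma be iterated over the
  generators.\<close>

lemma localized_field_adjoin:
  fixes R :: "'a::field set"
  assumes R: "subring_set R" and s': "s' \<in> ring_gen (insert a R)" "s' \<noteq> 0"
    and inv: "\<And>r. r \<in> ring_gen (insert a R) \<Longrightarrow> r \<noteq> 0 \<Longrightarrow> 1 / r \<in> localize (ring_gen (insert a R)) s'"
  shows "\<exists>s C. s \<in> R \<and> s \<noteq> 0 \<and> finite C \<and> localize (ring_gen (insert a R)) s' \<subseteq> span_over (localize R s) C \<and>
          (\<forall>r\<in>R. r \<noteq> 0 \<longrightarrow> 1 / r \<in> localize R s)"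
proof -
  note cl = coeffs_in_closed[OF R] and R1 = ring_gen_insert_eq_poly[OF R, of a] and RD = subring_setD[OF R]
  obtain p where p: "coeffs_in R p" "p \<noteq> 0" "poly p a = 0"
    and min: "\<And>q. coeffs_in R q \<Longrightarrow> q \<noteq> 0 \<Longrightarrow> poly q a = 0 \<Longrightarrow> degree p \<le> degree q"
    using ex_has_least_nat[of "\<lambda>p. coeffs_in R p \<and> p \<noteq> 0 \<and> poly p a = 0" _ degree]
      localized_field_adjoin_algebraic[OF R s' inv] by blast
  define d where "d = degree p"
  define t where "t = lead_coeff p"
  have t: "t \<in> R" "t \<noteq> 0" using p by (auto simp: t_def coeffs_in_def)
  have d: "d > 0"
  proof (rule ccontr)
    assume "\<not> d > 0"
    then obtain c where "p = [:c:]" by (metis d_def degree_eq_zeroE gr0I)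
    then show False using p by auto
  qed
  have reduce: "\<exists>k r. coeffs_in R r \<and> degree r < d \<and> poly f a = poly r a / t ^ k" if "coeffs_in R f" for f
  proof -
    from pseudo_division_in_subring[OF R p(1) _ that] d obtain k q r where
      "coeffs_in R r" "degree r < d" "smult (t ^ k) f = p * q + r"
      by (auto simp: d_def t_def)
    moreover from this(3) have "poly (smult (t ^ k) f) a = poly (p * q + r) a" by (rule arg_cong)
    then have "t ^ k * poly f a = poly r a" using p(3) by simp
    ultimately show ?thesis using t by (intro exI[of _ k] exI[of _ r]) (auto simp: field_simps)
  qed
  obtain g0 where g0: "coeffs_in R g0" "s' = poly g0 a" using s'(1) R1 by auto
  obtain l g where g: "coeffs_in R g" "degree g < d" "s' = poly g a / t ^ l"
    using reduce[OF g0(1)] g0 by auto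
  then have "g \<noteq> 0" using s' by auto
  then obtain h where h: "coeffs_in R h" "poly g a * poly h a \<in> R - {0}"
    using minimal_annihilator_inverse[OF R p min g(1)] g d_def by blast
  define w where "w = poly g a * poly h a"
  have w: "w \<in> R" "w \<noteq> 0" using h by (auto simp: w_def)
  have s'inv: "1 / s' = t ^ l * poly h a / w" using w t unfolding w_def g(3) by auto
  define s where "s = t * w"
  have s: "s \<in> R" "s \<noteq> 0" using t w RD by (auto simp: s_def)
  have normal: "\<exists>r m. coeffs_in R r \<and> degree r < d \<and> x = poly r a / s ^ m"
    if "x \<in> localize (ring_gen (insert a R)) s'" for x
  proof -
    from that obtain q k where q: "coeffs_in R q" "x = poly q a / s' ^ k"
      using R1 by (auto simp: localize_def)
    have "x = poly q a * (1 / s') ^ k" using q by (simp add: power_one_over field_simps)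
    also have "\<dots> = poly (q * smult ((t ^ l) ^ k) (h ^ k)) a / w ^ k"
      by (simp add: s'inv power_mult_distrib power_divide)
    finally have x: "x = poly (q * smult ((t ^ l) ^ k) (h ^ k)) a / w ^ k" .
    have "coeffs_in R (q * smult ((t ^ l) ^ k) (h ^ k))" using q h t by (intro cl RD)
    from reduce[OF this] obtain j r where r: "coeffs_in R r" "degree r < d" "x = poly r a / t ^ j / w ^ k"
      unfolding x by metis
    \<comment> \<open>The denominators \<open>t ^ j\<close> and \<open>w ^ k\<close> have different
      exponents; the factor \<open>t ^ k * w ^ j\<close> raises both to \<open>k + j\<close>, which
      gives a power of \<open>s\<close>.\<close>
    have "x = poly (smult (t ^ k * w ^ j) r) a / s ^ (k + j)"
      using t w by (simp add: r(3) s_def field_simps power_add power_mult_distrib)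
    moreover have "coeffs_in R (smult (t ^ k * w ^ j) r)" using r t w by (intro cl RD)
    moreover have "degree (smult (t ^ k * w ^ j) r) < d" using r(2) by (rule le_less_trans[OF degree_smult_le])
    ultimately show ?thesis by blast
  qed
  define A where "A = localize R s"
  have A: "subring_set A" unfolding A_def by (rule subring_set_localize[OF R s])
  define C where "C = (\<lambda>i. a ^ i) ` {..<d}"
  have C: "finite C" by (simp add: C_def)
  have "x \<in> span_over A C" if x: "x \<in> localize (ring_gen (insert a R)) s'" for x
  proof -
    from normal[OF x] obtain r m where r: "coeffs_in R r" "degree r < d" "x = poly r a / s ^ m" by blast
    have "x = (\<Sum>i\<le>degree r. (coeff r i / s ^ m) * a ^ i)"
      by (simp add: r(3) poly_altdef sum_divide_distrib)
    also have "\<dots> \<in> span_over A C"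
      using r by (intro span_over_sum[OF A] span_over_scaled_base C subring_setD[OF A])
        (auto simp: C_def A_def coeffs_in_def intro: localizeI)
    finally show ?thesis .
  qed
  moreover have "1 / \<rho> \<in> A" if \<rho>: "\<rho> \<in> R" "\<rho> \<noteq> 0" for \<rho>
  proof -
    have "1 / \<rho> \<in> localize (ring_gen (insert a R)) s'" using \<rho> by (intro inv ring_gen.gen) auto
    from normal[OF this] obtain r m where r: "coeffs_in R r" "degree r < d" "1 / \<rho> = poly r a / s ^ m" by blast
    \<comment> \<open>Clearing denominators in \<open>1 / \<rho> = poly r a / s ^ m\<close> gives a
      polynomial of degree below \<open>d\<close> that annihilates \<open>a\<close>. It vanishes by
      minimality, and its constant coefficient expresses \<open>1 / \<rho>\<close> without
      \<open>a\<close>.\<close>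
    define f where "f = smult \<rho> r - [:s ^ m:]"
    have "poly f a = 0" using r(3) \<rho> s by (simp add: f_def field_simps)
    moreover have "coeffs_in R f" unfolding f_def using r \<rho> s by (intro cl RD)
    moreover have "degree f < d" unfolding f_def using r(2) d
      by (intro degree_diff_less) (auto intro: le_less_trans[OF degree_smult_le])
    ultimately have "f = 0" using min[of f] d_def by force
    then have "coeff f 0 = 0" by simp
    then have "\<rho> * coeff r 0 = s ^ m" by (simp add: f_def)
    then have "1 / \<rho> = coeff r 0 / s ^ m" using \<rho> s by (simp add: field_simps)
    then show ?thesis using r(1) by (auto simp: A_def coeffs_in_def intro: localizeI)
  qed
  ultimately show ?thesis using s C unfolding A_def by blast
qed


text \<open>\<open>R\<close> varies in the induction: one generator \<open>a\<close> is moved into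
  the base ring, the induction hypothesis is applied to \<open>R[a]\<close>, and
  \<open>localized_field_adjoin\<close> brings the result back to \<open>R\<close>.\<close>

lemma finitely_generated_field_span:
  fixes R :: "'a::field set"
  assumes "finite T" "subring_set R" "ring_gen (R \<union> T) = UNIV"
  shows "\<exists>s B. s \<in> R \<and> s \<noteq> 0 \<and> finite B \<and> span_over (localize R s) B = UNIV \<and>
          (\<forall>r\<in>R. r \<noteq> 0 \<longrightarrow> 1 / r \<in> localize R s)"
  using assms
proof (induction T arbitrary: R rule: finite_induct)
  case empty
  have R: "R = UNIV" using ring_gen_least[OF empty(1), of R] empty(2) by auto
  have "x \<in> span_over UNIV {1}" for x :: 'a
    using span_over_scaled_base[of "{1}" UNIV "1::'a" x] by simp
  moreover have "localize UNIV (1::'a) = UNIV" by (auto simp: localize_def)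
  ultimately show ?case unfolding R by (intro exI[of _ 1] exI[of _ "{1}"]) auto
next
  case (insert a T)
  define R1 where "R1 = ring_gen (insert a R)"
  have "ring_gen (R1 \<union> T) = ring_gen (R \<union> insert a T)"
    unfolding R1_def ring_gen_Un_ring_gen by (rule arg_cong[of _ _ ring_gen]) auto
  then obtain s' B where s': "s' \<in> R1" "s' \<noteq> 0" and B: "finite B" "span_over (localize R1 s') B = UNIV"
    and inv: "\<forall>r\<in>R1. r \<noteq> 0 \<longrightarrow> 1 / r \<in> localize R1 s'"
    using insert.IH[of R1] insert.prems subring_set_ring_gen unfolding R1_def by metis
  obtain s C where s: "s \<in> R" "s \<noteq> 0" and C: "finite C" "localize R1 s' \<subseteq> span_over (localize R s) C"
    and inv': "\<forall>r\<in>R. r \<noteq> 0 \<longrightarrow> 1 / r \<in> localize R s"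
    using localized_field_adjoin[OF insert.prems(1), of s' a] s' inv unfolding R1_def by blast
  define A where "A = localize R s"
  have A: "subring_set A" unfolding A_def by (rule subring_set_localize[OF insert.prems(1) s])
  note AD = subring_setD[OF A]
  \<comment> \<open>As in the tower law for degrees, the products of the two spanning sets span over
    the smaller ring.\<close>
  define P where "P = (\<lambda>(c, b). c * b) ` (C \<times> B)"
  have P: "finite P" using B C by (simp add: P_def)
  have "span_over A C \<subseteq> {y. y * b \<in> span_over A P}" if "b \<in> B" for b
  proof (rule span_over_least)
    fix c x assume "c \<in> A" "x \<in> C"
    then show "c * x \<in> {y. y * b \<in> span_over A P}"
      using that span_over_scaled_base[OF P AD(1), of "x * b" c] by (force simp: P_def mult.assoc)
  qed (auto simp: distrib_right intro: span_over_zero span_over_add AD)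
  then have "span_over (localize R1 s') B \<subseteq> span_over A P"
    using C by (intro span_over_least span_over_zero span_over_add AD) (auto simp: A_def)
  then show ?case using B s P inv' unfolding A_def by blast
qed

section \<open>Finiteness of a field that is finitely generated as a ring\<close>

lemma ring_gen_empty: "ring_gen ({} :: 'a::ring_1 set) = range of_int"
proof
  have "subring_set (range of_int :: 'a set)" unfolding subring_set_def
    by (auto simp flip: of_int_diff of_int_mult) (metis of_int_1 rangeI)
  then show "ring_gen ({} :: 'a set) \<subseteq> range of_int" by (rule ring_gen_least) auto
  have nat: "of_nat n \<in> ring_gen ({} :: 'a set)" for n
    by (induction n) (auto intro: subring_setD[OF subring_set_ring_gen])
  have "of_int z \<in> ring_gen ({} :: 'a set)" for z
    by (cases z rule: int_cases2) (auto intro: nat subring_setD[OF subring_set_ring_gen])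
  then show "range of_int \<subseteq> ring_gen ({} :: 'a set)" by auto
qed

lemma finite_range_of_int:
  assumes "p > 0" "of_nat p = (0::'a::ring_1)"
  shows "finite (range of_int :: 'a set)"
proof (rule finite_subset)
  have "of_int z = (of_int (z mod int p) :: 'a)" for z
  proof -
    have "(of_int z :: 'a) = of_int (int p * (z div int p) + z mod int p)" by simp
    also have "\<dots> = of_int (z mod int p)" using assms(2) by (simp only: of_int_add of_int_mult) simp
    finally show ?thesis .
  qed
  then show "range of_int \<subseteq> (of_int :: int \<Rightarrow> 'a) ` {0..<int p}"
    using assms(1) by (auto intro!: image_eqI[of _ _ "_ mod int p"])
qed simp

text \<open>The base ring is the image of the integers. In positive characteristic it is finite, and
  so is a finite span over its localization. In characteristic zero, all nonzero integers would be
  invertible after inverting a single integer \<open>m\<close>.\<close>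

theorem finite_field_if_finitely_generated:
  assumes T: "finite T" and gen: "ring_gen T = (UNIV :: 'a::field set)"
  shows "finite (UNIV :: 'a set)"
proof -
  define R where "R = ring_gen ({} :: 'a set)"
  have "ring_gen (R \<union> T) = UNIV" unfolding R_def ring_gen_Un_ring_gen using gen by simp
  then obtain s B where s: "s \<in> R" "s \<noteq> 0" and B: "finite B" "span_over (localize R s) B = UNIV"
    and inv: "\<forall>r\<in>R. r \<noteq> 0 \<longrightarrow> 1 / r \<in> localize R s"
    using finitely_generated_field_span[OF T, of R] subring_set_ring_gen[of "{}"] unfolding R_def by metis
  note RD = subring_setD[OF subring_set_ring_gen[of "{}::'a set"], folded R_def]
  obtain m where m: "s = of_int m" using s ring_gen_empty unfolding R_def by auto
  show ?thesis
  proof (cases "\<exists>p>0. of_nat p = (0::'a)")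
    case True
    then have fin: "finite R" using finite_range_of_int unfolding R_def ring_gen_empty by blast
    \<comment> \<open>Every \<open>s ^ k\<close> stays in the finite set \<open>R\<close>, so
      unbounded exponents still give only finitely many fractions.\<close>
    have "localize R s \<subseteq> (\<lambda>(x, y). x / y) ` (R \<times> R)"
      using s RD by (force simp: localize_def)
    then have "finite (localize R s)" using fin by (meson finite_SigmaI finite_imageI finite_subset)
    then show ?thesis using finite_span_over[OF _ B(1)] B(2) by metis
  next
    case False
    have char0: "z = 0" if "of_int z = (0::'a)" for z
    proof (rule ccontr)
      assume "z \<noteq> 0"
      then have "nat \<bar>z\<bar> > 0" by simp
      moreover have "of_nat (nat \<bar>z\<bar>) = (0::'a)" using that by (cases "z \<ge> 0") (auto simp: of_nat_nat)
      ultimately show False using False by blast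
    qed
    \<comment> \<open>Prime to \<open>m\<close> and, since \<open>m \<noteq> 0\<close>, larger than
      \<open>1\<close>; so it divides no power of \<open>m\<close>.\<close>
    define r where "r = \<bar>m\<bar> + 1"
    have m0: "m \<noteq> 0" using s m by auto
    have "of_int r \<noteq> (0::'a)" using char0[of r] by (auto simp: r_def)
    moreover have "of_int r \<in> R" unfolding R_def ring_gen_empty by blast
    ultimately have "1 / of_int r \<in> localize R s" using inv by blast
    then obtain q k where "q \<in> R" "1 / of_int r = q / s ^ k"
      unfolding localize_def by blast
    moreover from this(1) obtain z where "q = of_int z" unfolding R_def ring_gen_empty by auto
    ultimately have "of_int (m ^ k - z * r) = (0::'a)"
      using s m \<open>of_int r \<noteq> (0::'a)\<close> by (simp add: field_simps)
    then have "m ^ k = z * r" using char0 by fastforce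
    then have "r dvd m ^ k" by simp
    moreover have "coprime r (m ^ k)"
    proof -
      have "coprime r m"
      proof (rule coprimeI)
        fix c assume "c dvd r" "c dvd m"
        then have "c dvd r - \<bar>m\<bar>" by (intro dvd_diff) auto
        then show "is_unit c" by (simp add: r_def)
      qed
      then show ?thesis by simp
    qed
    ultimately have "is_unit r" using coprime_common_divisor dvd_refl by blast
    then show ?thesis using m0 by (simp add: r_def)
  qed
qed

section \<open>Commutative subfields of a division ring\<close>

definition commutative_subfield :: "'a::division_ring set \<Rightarrow> bool" where
  "commutative_subfield Z \<longleftrightarrow> subring_set Z \<and> (\<forall>x\<in>Z. inverse x \<in> Z) \<and> (\<forall>x\<in>Z. \<forall>y\<in>Z. x * y = y * x)"

lemma commutative_subfield_center_of:
  fixes K :: "'a::division_ring set"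
  assumes K: "subring_set K" and inv: "\<And>x. x \<in> K \<Longrightarrow> inverse x \<in> K"
  shows "commutative_subfield (center_of K)"
  unfolding commutative_subfield_def subring_set_def
proof (intro conjI ballI)
  note KD = subring_setD[OF K]
  show "1 \<in> center_of K" using KD by (simp add: center_of_def)
  fix x assume x: "x \<in> center_of K"
  then have xc: "x * z = z * x" if "z \<in> K" for z using that by (auto simp: center_of_def)
  have xK: "x \<in> K" using x by (simp add: center_of_def)
  show "inverse x \<in> center_of K"
  proof (cases "x = 0")
    case False
    have "inverse x * z = z * inverse x" if "z \<in> K" for z
    proof -
      have "inverse x * z = inverse x * (z * x) * inverse x" using False by (simp add: mult.assoc)
      also have "\<dots> = inverse x * (x * z) * inverse x" using xc[OF that] by simp
      also have "\<dots> = z * inverse x" using False by (simp flip: mult.assoc)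
      finally show ?thesis .
    qed
    then show ?thesis using inv[OF xK] by (simp add: center_of_def)
  qed (use x in simp)
  fix y assume y: "y \<in> center_of K"
  then have yK: "y \<in> K" by (simp add: center_of_def)
  have yc: "y * z = z * y" if "z \<in> K" for z using y that by (auto simp: center_of_def)
  show "x * y = y * x" by (rule xc[OF yK])
  show "x - y \<in> center_of K"
    using xK yK xc yc KD by (simp add: center_of_def left_diff_distrib right_diff_distrib)
  have "x * y * z = z * (x * y)" if "z \<in> K" for z
    using xc[OF that] yc[OF that] by (metis mult.assoc)
  then show "x * y \<in> center_of K" using xK yK KD by (simp add: center_of_def)
qed

lemma center_eq_center_of: "center = center_of UNIV"
  by (simp add: center_def center_of_def)

lemma commutative_subfield_center: "commutative_subfield (center :: 'a::division_ring set)"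
  unfolding center_eq_center_of
  by (rule commutative_subfield_center_of) (auto simp: subring_set_def)

definition infinite_fg_subfield :: "'a::division_ring set \<Rightarrow> bool" where
  "infinite_fg_subfield Z \<longleftrightarrow> commutative_subfield Z \<and> infinite Z \<and> (\<exists>T. finite T \<and> ring_gen T = Z)"

text \<open>Polynomial arithmetic needs a field type. A type cannot depend on a given subfield, but it can be
  carved out of one chosen counterexample (or of the center, if there is none).\<close>

definition witness_subfield :: "'a::division_ring set" where
  "witness_subfield = (if \<exists>Z::'a set. infinite_fg_subfield Z then SOME Z. infinite_fg_subfield Z else center)"

lemma commutative_subfield_witness: "commutative_subfield witness_subfield"
  using someI_ex[of infinite_fg_subfield] commutative_subfield_center
  by (auto simp: witness_subfield_def infinite_fg_subfield_def)

lemma subring_set_witness: "subring_set witness_subfield"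
  using commutative_subfield_witness by (auto simp: commutative_subfield_def)

typedef (overloaded) 'a subfield = "witness_subfield :: 'a::division_ring set"
  using subring_setD(1)[OF subring_set_witness] by blast

setup_lifting type_definition_subfield

instantiation subfield :: (division_ring) field
begin

lift_definition zero_subfield :: "'a subfield" is 0 by (rule subring_setD[OF subring_set_witness])
lift_definition one_subfield :: "'a subfield" is 1 by (rule subring_setD[OF subring_set_witness])
lift_definition plus_subfield :: "'a subfield \<Rightarrow> 'a subfield \<Rightarrow> 'a subfield" is "(+)"
  by (rule subring_setD[OF subring_set_witness])
lift_definition minus_subfield :: "'a subfield \<Rightarrow> 'a subfield \<Rightarrow> 'a subfield" is "(-)"
  by (rule subring_setD[OF subring_set_witness])
lift_definition uminus_subfield :: "'a subfield \<Rightarrow> 'a subfield" is uminus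
  by (rule subring_setD[OF subring_set_witness])
lift_definition times_subfield :: "'a subfield \<Rightarrow> 'a subfield \<Rightarrow> 'a subfield" is "(*)"
  by (rule subring_setD[OF subring_set_witness])
lift_definition inverse_subfield :: "'a subfield \<Rightarrow> 'a subfield" is inverse
  using commutative_subfield_witness by (auto simp: commutative_subfield_def)
definition divide_subfield :: "'a subfield \<Rightarrow> 'a subfield \<Rightarrow> 'a subfield" where
  "divide_subfield x y = x * inverse y"

instance
proof
  fix a b c :: "'a subfield"
  show "a * b = b * a"
    by transfer (use commutative_subfield_witness in \<open>auto simp: commutative_subfield_def\<close>)
  show "a * b * c = a * (b * c)" by transfer (rule mult.assoc)
  show "1 * a = a" by transfer simp
  show "a + b + c = a + (b + c)" by transfer (rule add.assoc)
  show "a + b = b + a" by transfer (rule add.commute)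
  show "0 + a = a" by transfer simp
  show "- a + a = 0" by transfer simp
  show "a - b = a + - b" by transfer simp
  show "(a + b) * c = a * c + b * c" by transfer (rule distrib_right)
  show "(0::'a subfield) \<noteq> 1" by transfer simp
  show "a \<noteq> 0 \<Longrightarrow> inverse a * a = 1" by transfer simp
  show "a div b = a * inverse b" by (rule divide_subfield_def)
  show "inverse (0::'a subfield) = 0" by transfer simp
qed

end

text \<open>The type \<open>'a subfield\<close> stands for \<open>witness_subfield\<close>, not for
  \<open>Z\<close>. A counterexample \<open>Z\<close> only guarantees that the witness is a
  counterexample too, and the result on field types refutes that one.\<close>

theorem finitely_generated_subfield_finite:
  fixes Z :: "'a::division_ring set"
  assumes "commutative_subfield Z" "finite T" "ring_gen T = Z"
  shows "finite Z"
proof (rule ccontr)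
  assume "infinite Z"
  then have "infinite_fg_subfield Z" using assms by (auto simp: infinite_fg_subfield_def)
  then have "infinite_fg_subfield (witness_subfield :: 'a set)"
    using someI[of infinite_fg_subfield Z] by (auto simp: witness_subfield_def)
  then obtain U where U: "finite U" "ring_gen U = (witness_subfield :: 'a set)"
    and inf: "infinite (witness_subfield :: 'a set)" by (auto simp: infinite_fg_subfield_def)
  define V where "V = Abs_subfield ` U"
  have "Abs_subfield x \<in> ring_gen V" if "x \<in> ring_gen U" for x
    using that
  proof induction
    case (diff x y)
    then have "Abs_subfield (x - y) = Abs_subfield x - Abs_subfield y"
      using U by (simp add: minus_subfield.abs_eq eq_onp_same_args)
    then show ?case using diff by (simp add: ring_gen.diff)
  next
    case (mult x y)
    then have "Abs_subfield (x * y) = Abs_subfield x * Abs_subfield y"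
      using U by (simp add: times_subfield.abs_eq eq_onp_same_args)
    then show ?case using mult by (simp add: ring_gen.mult)
  qed (auto simp: V_def one_subfield.abs_eq[symmetric] intro: ring_gen.gen ring_gen.one)
  then have "ring_gen V = UNIV"
    using U by (metis Abs_subfield_cases UNIV_eq_I)
  then have "finite (UNIV :: 'a subfield set)"
    using finite_field_if_finitely_generated[of V] U by (simp add: V_def)
  then have "finite (Rep_subfield ` (UNIV :: 'a subfield set))" by simp
  then show False using inf type_definition.Rep_range[OF type_definition_subfield] by metis
qed

subsection \<open>Division rings with torsion unit group\<close>

lemma torsion_inverse_in_subring:
  fixes x :: "'a::division_ring"
  assumes "subring_set R" "x \<in> R" "n > 0" "x ^ n = 1"
  shows "inverse x \<in> R"
proof -
  have "x * x ^ (n - 1) = 1" using assms(3,4) by (metis Suc_diff_1 power_Suc)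
  then have "inverse x = x ^ (n - 1)" by (simp add: inverse_unique)
  then show ?thesis using assms by (simp add: subring_setD)
qed

text \<open>The span of a multiplicatively closed set over the image of the integers is already a
  ring, because integers are central; it is finite because that image is.\<close>

lemma finite_ring_gen_monoid:
  fixes G :: "'a::ring_1 set"
  assumes G: "finite G" "1 \<in> G" "\<And>x y. x \<in> G \<Longrightarrow> y \<in> G \<Longrightarrow> x * y \<in> G"
    and p: "p > 0" "of_nat p = (0::'a)"
  shows "finite (ring_gen G)"
proof -
  define A :: "'a set" where "A = range of_int"
  have A: "subring_set A" unfolding A_def ring_gen_empty[symmetric] by (rule subring_set_ring_gen)
  note AD = subring_setD[OF A]
  have comm: "c * x = x * c" if "c \<in> A" for c x :: 'a
    using that by (auto simp: A_def mult_of_int_commute)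
  have base: "g \<in> span_over A G" if "g \<in> G" for g
    using span_over_scaled_base[OF G(1) AD(1) that AD(2)] by simp
  have "subring_set (span_over A G)" unfolding subring_set_def
  proof (intro conjI ballI)
    show "1 \<in> span_over A G" by (rule base[OF G(2)])
    fix x y assume xy: "x \<in> span_over A G" "y \<in> span_over A G"
    have "x + (- 1) * y \<in> span_over A G"
      by (intro span_over_add span_over_scale AD xy)
    then show "x - y \<in> span_over A G" by simp
    have "span_over A G \<subseteq> {u. u * y \<in> span_over A G}"
    proof (rule span_over_least)
      fix c g assume cg: "c \<in> A" "g \<in> G"
      have "span_over A G \<subseteq> {v. g * v \<in> span_over A G}"
      proof (rule span_over_least)
        fix d h assume dh: "d \<in> A" "h \<in> G"
        have "g * (d * h) = d * (g * h)" using comm[OF dh(1), of g] by (metis mult.assoc)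
        then show "d * h \<in> {v. g * v \<in> span_over A G}"
          using span_over_scaled_base[OF G(1) AD(1) G(3)[OF cg(2) dh(2)] dh(1)] by simp
      qed (auto simp: distrib_left intro: span_over_zero span_over_add AD)
      then have "g * y \<in> span_over A G" using xy by auto
      then show "c * g \<in> {u. u * y \<in> span_over A G}"
        using cg by (auto simp: mult.assoc intro: span_over_scale AD)
    qed (auto simp: distrib_right intro: span_over_zero span_over_add AD)
    then show "x * y \<in> span_over A G" using xy by auto
  qed
  then have "ring_gen G \<subseteq> span_over A G" by (rule ring_gen_least) (auto intro: base)
  moreover have "finite (span_over A G)"
    unfolding A_def by (intro finite_span_over finite_range_of_int[OF p] G(1))
  ultimately show ?thesis by (rule finite_subset)
qed

lemma finite_powers:
  fixes x :: "'a::monoid_mult"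
  assumes "n > 0" "x ^ n = 1"
  shows "finite (range (\<lambda>i. x ^ i))"
proof (rule finite_subset)
  have "x ^ i = x ^ (i mod n)" for i
  proof -
    have "x ^ i = x ^ (n * (i div n) + i mod n)" by simp
    also have "\<dots> = x ^ (i mod n)" unfolding power_add power_mult assms(2) by simp
    finally show ?thesis .
  qed
  then show "range (\<lambda>i. x ^ i) \<subseteq> (\<lambda>i. x ^ i) ` {..<n}"
    using assms(1) by (auto intro!: image_eqI[of _ _ "_ mod n"])
qed simp

lemma commuting_power_right:
  fixes a b :: "'a::monoid_mult"
  assumes "a * b = b * a"
  shows "a * b ^ n = b ^ n * a"
  by (induction n) (simp_all add: assms, metis assms mult.assoc)

lemma commuting_powers:
  fixes a b :: "'a::monoid_mult"
  assumes "a * b = b * a"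
  shows "a ^ m * b ^ n = b ^ n * a ^ m"
  using commuting_power_right[OF commuting_power_right[OF assms, of n, symmetric], of m] by simp

lemma finite_ring_gen_two_commuting:
  fixes a b :: "'a::ring_1"
  assumes "a * b = b * a" "m > 0" "a ^ m = 1" "n > 0" "b ^ n = 1" "p > 0" "of_nat p = (0::'a)"
  shows "finite (ring_gen {a, b})"
proof -
  define G where "G = (\<lambda>(x, y). x * y) ` (range (\<lambda>i. a ^ i) \<times> range (\<lambda>i. b ^ i))"
  have mem: "a ^ i * b ^ j \<in> G" for i j by (auto simp: G_def)
  have "finite (ring_gen G)"
  proof (rule finite_ring_gen_monoid)
    show "finite G" unfolding G_def
      by (intro finite_imageI finite_cartesian_product finite_powers[OF assms(2,3)] finite_powers[OF assms(4,5)])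
    show "1 \<in> G" using mem[of 0 0] by simp
    fix x y assume "x \<in> G" "y \<in> G"
    then obtain i j k l where e: "x = a ^ i * b ^ j" "y = a ^ k * b ^ l" by (auto simp: G_def)
    have "x * y = a ^ i * (b ^ j * a ^ k) * b ^ l" by (simp add: e mult.assoc)
    also have "\<dots> = a ^ i * (a ^ k * b ^ j) * b ^ l" by (simp add: commuting_powers[OF assms(1)])
    also have "\<dots> = a ^ (i + k) * b ^ (j + l)" by (simp add: power_add mult.assoc)
    finally show "x * y \<in> G" using mem by simp
  qed fact+
  moreover have "a \<in> G" "b \<in> G" using mem[of 1 0] mem[of 0 1] by simp_all
  then have "ring_gen {a, b} \<subseteq> ring_gen G" by (intro ring_gen_mono) auto
  ultimately show ?thesis by (rule finite_subset[rotated])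
qed

lemma geometric_telescope:
  fixes q :: "'a::ring_1"
  shows "(q - 1) * (\<Sum>i<n. q ^ i) = q ^ n - 1"
  by (induction n) (simp_all add: algebra_simps)

lemma geometric_zero:
  fixes q :: "'a::division_ring"
  assumes "q ^ n = 1" "q \<noteq> 1"
  shows "(\<Sum>i<n. q ^ i) = 0"
  using geometric_telescope[of q n] assms by simp

text \<open>Lagrange's theorem by orbits: the cyclic group generated by \<open>a\<close> acts on the
  nonzero elements of \<open>M\<close> by left multiplication, and every orbit \<open>cl x\<close>
  has \<open>n\<close> elements.\<close>

lemma order_dvd_card_units:
  fixes M :: "'a::division_ring set"
  assumes M: "subring_set M" "finite M" "a \<in> M" and n: "n > 0" "a ^ n = 1"
    and least: "\<And>i. 0 < i \<Longrightarrow> i < n \<Longrightarrow> a ^ i \<noteq> 1"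
  shows "n dvd card (M - {0})"
proof -
  have a0: "a \<noteq> 0" using n by (auto simp: power_0_left)
  note MD = subring_setD[OF M(1)]
  define cl where "cl x = (\<lambda>i. a ^ i * x) ` {..<n}" for x
  have inj: "inj_on (\<lambda>i. a ^ i * x) {..<n}" if "x \<noteq> 0" for x
  proof (rule linorder_inj_onI)
    fix i j assume ij: "i < j" "i \<in> {..<n}" "j \<in> {..<n}"
    show "a ^ i * x \<noteq> a ^ j * x"
    proof
      assume "a ^ i * x = a ^ j * x"
      then have "a ^ i = a ^ j" using that by simp
      also have "\<dots> = a ^ i * a ^ (j - i)" using ij by (simp flip: power_add)
      finally have "a ^ i = a ^ i * a ^ (j - i)" .
      then have "a ^ (j - i) = 1" using a0 by simp
      then show False using least[of "j - i"] ij by (simp add: less_imp_diff_less)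
    qed
  qed auto
  have mem: "a ^ i * x \<in> cl x" for i x
  proof -
    have "a ^ i = a ^ (n * (i div n) + i mod n)" by simp
    also have "\<dots> = a ^ (i mod n)" unfolding power_add power_mult n(2) by simp
    finally show ?thesis using n(1) by (auto simp: cl_def intro!: image_eqI[of _ _ "i mod n"])
  qed
  have trans: "cl y \<subseteq> cl x" if "y \<in> cl x" for x y
    using that mem by (auto simp: cl_def simp flip: mult.assoc power_add)
  have sym: "x \<in> cl y" if "y \<in> cl x" for x y
  proof -
    from that obtain i where i: "i < n" "y = a ^ i * x" by (auto simp: cl_def)
    then have "a ^ (n - i) * y = x" using n by (simp flip: mult.assoc power_add)
    then show ?thesis using mem by metis
  qed
  have "n dvd card (\<Union> (cl ` (M - {0})))"
  proof (rule dvd_partition)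
    show "finite (\<Union> (cl ` (M - {0})))" using M by (auto simp: cl_def)
    show "\<forall>c\<in>cl ` (M - {0}). n dvd card c"
      using inj by (auto simp: cl_def card_image)
    show "\<forall>c1\<in>cl ` (M - {0}). \<forall>c2\<in>cl ` (M - {0}). c1 \<noteq> c2 \<longrightarrow> c1 \<inter> c2 = {}"
      using trans sym by (auto, blast+)
  qed
  moreover have "\<Union> (cl ` (M - {0})) = M - {0}"
  proof
    show "\<Union> (cl ` (M - {0})) \<subseteq> M - {0}" using a0 M by (auto simp: cl_def intro!: MD)
    show "M - {0} \<subseteq> \<Union> (cl ` (M - {0}))" using mem[of 0] by auto
  qed
  ultimately show ?thesis by simp
qed

text \<open>Translation by \<open>1\<close> permutes \<open>M\<close>, so the sum over
  \<open>M\<close> equals itself plus \<open>card M\<close>.\<close>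

lemma of_nat_card_subring:
  fixes M :: "'a::ring_1 set"
  assumes "subring_set M" "finite M"
  shows "of_nat (card M) = (0::'a)"
proof -
  have "(\<Sum>x\<in>M. x) = (\<Sum>x\<in>M. x + 1)"
    by (rule sum.reindex_bij_witness[of _ "\<lambda>x. x + 1" "\<lambda>x. x - 1"])
      (auto intro: subring_setD[OF assms(1)])
  then show ?thesis by (simp add: sum.distrib)
qed

text \<open>The order divides \<open>card M - 1\<close>, while \<open>card M\<close> vanishes in the
  ring; \<open>of_nat n = 0\<close> would give \<open>1 = 0\<close>. This is what permits cancelling
  \<open>n\<close> in \<open>noncommuting_eigenvector\<close>.\<close>

lemma of_nat_order_nonzero:
  fixes a :: "'a::division_ring"
  assumes M: "subring_set M" "finite M" "a \<in> M" and n: "n > 0" "a ^ n = 1"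
    and least: "\<And>i. 0 < i \<Longrightarrow> i < n \<Longrightarrow> a ^ i \<noteq> 1"
  shows "of_nat n \<noteq> (0::'a)"
proof
  assume 0: "of_nat n = (0::'a)"
  have "n dvd card (M - {0})" by (rule order_dvd_card_units[OF M n least])
  then obtain k where "card (M - {0}) = n * k" by (elim dvdE)
  moreover have "card M = Suc (card (M - {0}))"
    using M(2) subring_setD(1)[OF M(1)] by (metis card.remove)
  ultimately have "of_nat (card M) = (1::'a)" using 0 by simp
  then show False using of_nat_card_subring[OF M(1,2)] by simp
qed

text \<open>The elements \<open>E j\<close> are the isotypic components of \<open>y\<close> for right multiplication by \<open>a\<close>:
  a discrete Fourier transform over the group generated by \<open>a\<close>.\<close>

lemma noncommuting_eigenvector:
  fixes a y :: "'a::division_ring"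
  assumes n: "n > 0" "a ^ n = 1" and least: "\<And>i. 0 < i \<Longrightarrow> i < n \<Longrightarrow> a ^ i \<noteq> 1"
    and n0: "of_nat n \<noteq> (0::'a)" and ya: "y * a \<noteq> a * y"
  shows "\<exists>x j. x \<noteq> 0 \<and> x * a = a ^ j * x \<and> a ^ j \<noteq> a"
proof (rule ccontr)
  assume no: "\<not> ?thesis"
  have a0: "a \<noteq> 0" using n by (auto simp: power_0_left)
  define b where "b = inverse a"
  have ab: "a ^ k * b ^ k = 1" for k
    unfolding b_def power_inverse using a0 by simp
  have bn: "b ^ n = 1" using ab[of n] n by simp
  \<comment> \<open>The summands depend on \<open>i\<close> only modulo \<open>n\<close>, and
    multiplying by \<open>a\<close> on the right shifts \<open>i\<close> by one at the price of a
    factor \<open>a ^ j\<close> on the left.\<close>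
  define g where "g j i = b ^ (i * j) * y * a ^ i" for i j
  define E where "E j = (\<Sum>i<n. g j i)" for j
  have "E j * a = a ^ j * E j" for j
  proof -
    have "g j i * a = a ^ j * g j (Suc i)" for i
    proof -
      have "a ^ j * b ^ (Suc i * j) = b ^ (i * j)"
        using ab[of j] by (simp add: power_add flip: mult.assoc)
      then show ?thesis by (simp add: g_def power_Suc2 del: power_Suc flip: mult.assoc)
    qed
    then have "E j * a = a ^ j * (\<Sum>i<n. g j (Suc i))"
      by (simp add: E_def sum_distrib_left sum_distrib_right)
    also have "(\<Sum>i<n. g j (Suc i)) = E j"
    proof -
      have "g j n = g j 0" using n bn by (simp add: g_def power_mult)
      then show ?thesis using sum.lessThan_Suc_shift[of "g j" n] by (simp add: E_def)
    qed
    finally show ?thesis .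
  qed
  \<comment> \<open>Since no suitable \<open>x\<close> exists, each component is zero or has
    \<open>a ^ j = a\<close>; it commutes with \<open>a\<close> either way.\<close>
  then have "E j * a = a * E j" for j using no by (cases "a ^ j = a") (force, metis mult_zero_left mult_zero_right)
  then have "(\<Sum>j<n. E j) * a = a * (\<Sum>j<n. E j)" by (simp add: sum_distrib_left sum_distrib_right)
  \<comment> \<open>Fourier inversion: the geometric sums over \<open>j\<close> vanish except at
    \<open>i = 0\<close>, so the components add up to \<open>n\<close> times \<open>y\<close>, and
    \<open>y\<close> would commute with \<open>a\<close>.\<close>
  moreover have "(\<Sum>j<n. E j) = of_nat n * y"
  proof -
    have "(\<Sum>j<n. E j) = (\<Sum>i<n. \<Sum>j<n. g j i)" unfolding E_def by (rule sum.swap)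
    also have "\<dots> = (\<Sum>i<n. (\<Sum>j<n. (b ^ i) ^ j) * y * a ^ i)"
      by (simp add: g_def sum_distrib_right power_mult)
    also have "\<dots> = (\<Sum>i<n. if i = 0 then of_nat n * y else 0)"
    proof (rule sum.cong)
      fix i assume i: "i \<in> {..<n}"
      have "(\<Sum>j<n. (b ^ i) ^ j) = 0" if "i \<noteq> 0"
      proof (rule geometric_zero)
        show "(b ^ i) ^ n = 1" using bn by (metis power_mult mult.commute power_one)
        show "b ^ i \<noteq> 1" using ab[of i] least[of i] i that by auto
      qed
      then show "(\<Sum>j<n. (b ^ i) ^ j) * y * a ^ i = (if i = 0 then of_nat n * y else 0)" by simp
    qed simp
    also have "\<dots> = of_nat n * y" using n by simp
    finally show ?thesis .
  qed
  ultimately have "of_nat n * (y * a) = of_nat n * (a * y)"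
    by (metis mult.assoc mult_of_nat_commute)
  then show False using n0 ya by simp
qed

section \<open>Norms and Hilbert 90 for a cyclic action on a finite field\<close>

text \<open>\<open>M\<close> is a finite field on which conjugation by \<open>x\<close> is an
  automorphism of order \<open>k\<close>: \<open>x ^ k\<close> lies in \<open>M\<close> and acts
  trivially, while the lower powers move \<open>a\<close>. The aim is to show that this order is
  \<open>1\<close>.\<close>

locale cyclic_normalizer =
  fixes M :: "'a::division_ring set" and x a :: 'a and k :: nat
  assumes subring: "subring_set M" and finite: "finite M"
    and comm: "\<And>u v. u \<in> M \<Longrightarrow> v \<in> M \<Longrightarrow> u * v = v * u"
    and inverse_mem: "\<And>u. u \<in> M \<Longrightarrow> inverse u \<in> M"
    and x_nonzero: "x \<noteq> 0" and conj_mem: "\<And>u. u \<in> M \<Longrightarrow> x * u * inverse x \<in> M"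
    and a_mem: "a \<in> M" and k_pos: "k > 0" and xk_mem: "x ^ k \<in> M"
    and distinct: "\<And>i. 0 < i \<Longrightarrow> i < k \<Longrightarrow> x ^ i * a \<noteq> a * x ^ i"
begin

lemmas closed = subring_setD[OF subring]

definition conj :: "nat \<Rightarrow> 'a \<Rightarrow> 'a" where
  "conj i u = x ^ i * u * inverse (x ^ i)"

lemma power_mult_eq_conj: "x ^ i * u = conj i u * x ^ i"
  using x_nonzero by (simp add: conj_def mult.assoc)

lemma conj_Suc: "conj (Suc i) u = x * conj i u * inverse x"
  using x_nonzero by (simp add: conj_def nonzero_inverse_mult_distrib mult.assoc)

lemma conj_closed: "u \<in> M \<Longrightarrow> conj i u \<in> M"
  by (induction i) (simp_all add: conj_Suc conj_mem, simp add: conj_def)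

lemma conj_mult: "conj i (u * v) = conj i u * conj i v"
  using x_nonzero by (simp add: conj_def mult.assoc) (simp flip: mult.assoc)

lemma conj_k: "u \<in> M \<Longrightarrow> conj k u = u"
  using comm[OF xk_mem] x_nonzero by (simp add: conj_def mult.assoc)

lemma conj_a_distinct:
  assumes "i < j" "j < k"
  shows "conj i a \<noteq> conj j a"
proof
  assume eq: "conj i a = conj j a"
  have "conj j a * x ^ j = x ^ i * (x ^ (j - i) * a)"
    using power_mult_eq_conj[of j a] assms by (simp flip: mult.assoc power_add)
  moreover have "conj j a * x ^ j = x ^ i * (a * x ^ (j - i))"
    using power_mult_eq_conj[of i a] assms eq by (simp flip: mult.assoc) (simp add: mult.assoc flip: power_add)
  ultimately have "x ^ (j - i) * a = a * x ^ (j - i)" using x_nonzero by simp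
  then show False using distinct[of "j - i"] assms by (simp add: less_imp_diff_less)
qed

text \<open>Artin's independence of characters. The weights \<open>w\<close> serve two uses:
  \<open>w i = inverse (x ^ i)\<close> turns the terms into multiples of \<open>conj i z\<close>,
  and \<open>w i = 1\<close> gives independence of the powers of \<open>x\<close> over
  \<open>M\<close>.\<close>

lemma powers_independent:
  assumes "I \<subseteq> {..<k}" "\<And>i. i \<in> I \<Longrightarrow> e i \<in> M" "\<And>i. i \<in> I \<Longrightarrow> w i \<noteq> 0"
    and "\<And>z. z \<in> M \<Longrightarrow> (\<Sum>i\<in>I. e i * x ^ i * z * w i) = 0"
  shows "\<forall>i\<in>I. e i = 0"
proof -
  have "finite I" using assms(1) finite_subset by auto
  then show ?thesis using assms
  proof (induction I arbitrary: e rule: finite_induct)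
    case (insert j I)
    \<comment> \<open>Replacing \<open>z\<close> by \<open>a * z\<close> multiplies term
      \<open>i\<close> by \<open>conj i a\<close>. Subtracting \<open>conj j a\<close> times the
      original relation removes term \<open>j\<close> and multiplies the others by the nonzero
      factors \<open>conj i a - conj j a\<close>.\<close>
    define e' where "e' i = e i * (conj i a - conj j a)" for i
    have "\<forall>i\<in>I. e' i = 0"
    proof (rule insert.IH)
      show "I \<subseteq> {..<k}" "\<And>i. i \<in> I \<Longrightarrow> w i \<noteq> 0" using insert.prems by auto
      show "e' i \<in> M" if "i \<in> I" for i
        using that insert.prems by (auto simp: e'_def intro!: closed conj_closed a_mem)
      fix z assume z: "z \<in> M"
      have 1: "e i * x ^ i * (a * z) * w i - conj j a * (e i * x ^ i * z * w i) = e' i * x ^ i * z * w i"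
        if "i \<in> insert j I" for i
      proof -
        have "e i * x ^ i * (a * z) * w i = e i * conj i a * x ^ i * z * w i"
          using power_mult_eq_conj[of i a] by (metis mult.assoc)
        moreover have "conj j a * (e i * x ^ i * z * w i) = e i * conj j a * x ^ i * z * w i"
          using comm[OF conj_closed[OF a_mem, of j] insert.prems(2)[OF that]] by (metis mult.assoc)
        ultimately show ?thesis by (simp add: e'_def algebra_simps)
      qed
      have "(\<Sum>i\<in>insert j I. e' i * x ^ i * z * w i) =
        (\<Sum>i\<in>insert j I. e i * x ^ i * (a * z) * w i) - conj j a * (\<Sum>i\<in>insert j I. e i * x ^ i * z * w i)"
        unfolding sum_distrib_left sum_subtractf[symmetric] by (rule sum.cong) (simp_all add: 1)
      also have "\<dots> = 0" using insert.prems(4)[OF z] insert.prems(4)[of "a * z"] z a_mem closed(4) by simp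
      finally show "(\<Sum>i\<in>I. e' i * x ^ i * z * w i) = 0"
        using insert.hyps by (simp add: e'_def)
    qed
    moreover have "conj i a \<noteq> conj j a" if "i \<in> I" for i
    proof -
      have "i \<noteq> j" "i < k" "j < k" using that insert.hyps insert.prems(1) by auto
      then show ?thesis using conj_a_distinct[of i j] conj_a_distinct[of j i] by (metis linorder_neqE_nat)
    qed
    ultimately have z: "\<forall>i\<in>I. e i = 0" by (simp add: e'_def)
    then have "e j * x ^ j * 1 * w j = 0"
      using insert.prems(4)[of 1] insert.hyps closed(2) by simp
    then show ?case using z insert.prems(3)[of j] x_nonzero by simp
  qed simp
qed

text \<open>The partial norm, the product of \<open>conj l m\<close> over \<open>l < i\<close>, read
  off from \<open>(m * x) ^ i\<close>. For \<open>i = k\<close> it is the norm to the fixed field,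
  and it records how \<open>x ^ k\<close> changes when \<open>x\<close> is replaced by
  \<open>m * x\<close>.\<close>

definition norm_pow :: "nat \<Rightarrow> 'a \<Rightarrow> 'a" where
  "norm_pow i m = (m * x) ^ i * inverse (x ^ i)"

lemma power_eq_norm_pow: "(m * x) ^ i = norm_pow i m * x ^ i"
  using x_nonzero by (simp add: norm_pow_def mult.assoc)

lemma norm_pow_0: "norm_pow 0 m = 1"
  by (simp add: norm_pow_def)

lemma norm_pow_Suc: "norm_pow (Suc i) m = norm_pow i m * conj i m"
proof -
  have "norm_pow (Suc i) m * x ^ Suc i = (m * x) ^ i * (m * x)"
    unfolding power_eq_norm_pow[symmetric] by (rule power_Suc2)
  also have "\<dots> = norm_pow i m * (x ^ i * m) * x" by (simp add: power_eq_norm_pow mult.assoc)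
  also have "\<dots> = norm_pow i m * conj i m * x ^ Suc i"
    by (simp only: power_mult_eq_conj power_Suc2 mult.assoc)
  finally show ?thesis using x_nonzero by simp
qed

lemma norm_pow_Suc2: "norm_pow (Suc i) m = m * conj 1 (norm_pow i m)"
proof -
  have "norm_pow (Suc i) m * x ^ Suc i = m * (x * norm_pow i m) * x ^ i"
    unfolding power_eq_norm_pow[symmetric] by (simp add: power_eq_norm_pow mult.assoc)
  also have "\<dots> = m * conj 1 (norm_pow i m) * x ^ Suc i"
    using power_mult_eq_conj[of 1 "norm_pow i m"] by (simp add: mult.assoc)
  finally show ?thesis using x_nonzero by simp
qed

lemma norm_pow_closed: "m \<in> M \<Longrightarrow> norm_pow i m \<in> M"
  by (induction i) (auto simp: norm_pow_0 norm_pow_Suc intro: closed conj_closed)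

lemma norm_pow_mult:
  assumes "m \<in> M" "m' \<in> M"
  shows "norm_pow i (m * m') = norm_pow i m * norm_pow i m'"
proof (induction i)
  case (Suc i)
  have "norm_pow i m' * conj i m = conj i m * norm_pow i m'"
    using assms by (intro comm norm_pow_closed conj_closed)
  then show ?case unfolding norm_pow_Suc conj_mult Suc by (metis mult.assoc)
qed (simp add: norm_pow_0)

lemma norm_pow_nonzero: "m \<noteq> 0 \<Longrightarrow> norm_pow i m \<noteq> 0"
  using x_nonzero by (simp add: norm_pow_def)

definition fixed :: "'a set" where
  "fixed = {u \<in> M - {0}. x * u = u * x}"

text \<open>Splitting off the first or the last factor of \<open>norm_pow (Suc k) m\<close> gives
  two expressions for it, and \<open>conj k\<close> is the identity on \<open>M\<close>.\<close>

lemma norm_in_fixed: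
  assumes "m \<in> M - {0}"
  shows "norm_pow k m \<in> fixed"
proof -
  have m: "m \<in> M" "m \<noteq> 0" using assms by auto
  have "m * conj 1 (norm_pow k m) = norm_pow k m * conj k m"
    by (simp only: norm_pow_Suc[symmetric] norm_pow_Suc2[symmetric])
  also have "\<dots> = m * norm_pow k m" using conj_k comm norm_pow_closed m by simp
  finally have "conj 1 (norm_pow k m) = norm_pow k m" using m by simp
  then show ?thesis
    using power_mult_eq_conj[of 1 "norm_pow k m"] norm_pow_closed norm_pow_nonzero m by (simp add: fixed_def)
qed

definition coboundary :: "'a \<Rightarrow> 'a" where
  "coboundary b = b * inverse (conj 1 b)"

lemma conj_nonzero: "b \<noteq> 0 \<Longrightarrow> conj i b \<noteq> 0"
  using x_nonzero by (simp add: conj_def)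

text \<open>Hilbert's Theorem 90; \<open>b\<close> is the Lagrange resolvent of \<open>z\<close>.\<close>

lemma norm_one_imp_coboundary:
  assumes m: "m \<in> M - {0}" and norm: "norm_pow k m = 1"
  shows "m \<in> coboundary ` (M - {0})"
proof -
  have "\<exists>z\<in>M. (\<Sum>i<k. norm_pow i m * x ^ i * z * inverse (x ^ i)) \<noteq> 0"
  proof (rule ccontr)
    assume "\<not> ?thesis"
    then have "\<forall>i\<in>{..<k}. norm_pow i m = 0"
      using m x_nonzero by (intro powers_independent[of _ _ "\<lambda>i. inverse (x ^ i)"]) (auto intro: norm_pow_closed)
    then show False using k_pos norm_pow_0[of m] by force
  qed
  then obtain z where z: "z \<in> M" "(\<Sum>i<k. norm_pow i m * conj i z) \<noteq> 0"
    by (auto simp: conj_def mult.assoc)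
  define f where "f i = norm_pow i m * conj i z" for i
  define b where "b = (\<Sum>i<k. f i)"
  have b: "b \<in> M" "b \<noteq> 0"
    using z m by (auto simp: b_def f_def intro!: subring_set_sum[OF subring] closed norm_pow_closed conj_closed)
  have "m * conj 1 (f i) = f (Suc i)" for i
  proof -
    have "conj 1 (conj i z) = conj (Suc i) z" unfolding conj_Suc by (simp add: conj_def)
    then show ?thesis by (simp only: f_def conj_mult norm_pow_Suc2 mult.assoc)
  qed
  moreover have "conj 1 b = (\<Sum>i<k. conj 1 (f i))"
    by (simp add: b_def conj_def sum_distrib_left sum_distrib_right)
  ultimately have "m * conj 1 b = (\<Sum>i<k. f (Suc i))" by (simp add: sum_distrib_left)
  \<comment> \<open>The shift is cyclic: norm one and \<open>conj k z = z\<close> give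
    \<open>f k = f 0\<close>.\<close>
  also have "\<dots> = b"
  proof -
    have "f k = f 0" using norm conj_k[OF z(1)] by (simp add: f_def norm_pow_0) (simp add: conj_def)
    then show ?thesis using sum.lessThan_Suc_shift[of f k] by (simp add: b_def)
  qed
  finally have "m = coboundary b"
    using conj_nonzero[OF b(2), of 1] by (simp add: coboundary_def) (metis mult.assoc right_inverse mult_1_right)
  then show ?thesis using b by blast
qed

text \<open>On the unit group of \<open>M\<close>, the fibres of \<open>coboundary\<close> are the cosets of \<open>fixed\<close>, and by Hilbert 90 the
  fibres of the norm are no larger than the image of \<open>coboundary\<close>; so the norm has at least as many
  values as \<open>fixed\<close> has elements.\<close>

lemma norm_surjective:
  assumes "c \<in> fixed"
  shows "\<exists>m\<in>M - {0}. norm_pow k m = c"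
proof -
  define U where "U = M - {0}"
  define T where "T = coboundary ` U"
  define N where "N = norm_pow k ` U"
  have fin: "finite U" "finite T" "finite N" "finite fixed"
    using finite by (auto simp: U_def T_def N_def fixed_def)
  define g where "g = inv_into U coboundary"
  have g: "g t \<in> U" "coboundary (g t) = t" if "t \<in> T" for t
    using that unfolding g_def T_def by (auto intro: inv_into_into f_inv_into_f)
  have cob: "coboundary (b * f) = coboundary b" if "b \<in> U" "f \<in> fixed" for b f
  proof -
    have f: "f \<in> M" "f \<noteq> 0" "conj 1 f = f"
      using that x_nonzero by (auto simp: fixed_def conj_def mult.assoc)
    have "b * f * inverse (conj 1 b * f) = b * inverse (conj 1 b)"
      using f conj_nonzero[of b 1] that by (simp add: U_def nonzero_inverse_mult_distrib mult.assoc) (simp flip: mult.assoc)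
    then show ?thesis using f by (simp add: coboundary_def conj_mult)
  qed
  have "card (T \<times> fixed) \<le> card U"
  proof (rule card_inj_on_le[of "\<lambda>(t, f). g t * f"])
    show "inj_on (\<lambda>(t, f). g t * f) (T \<times> fixed)"
    proof (rule inj_onI, clarify)
      fix t f t' f' assume h: "t \<in> T" "f \<in> fixed" "t' \<in> T" "f' \<in> fixed" "g t * f = g t' * f'"
      then have "t = t'" using cob[OF g(1)] g(2) by metis
      then show "t = t' \<and> f = f'" using h g(1)[of t] by (auto simp: U_def)
    qed
    show "(\<lambda>(t, f). g t * f) ` (T \<times> fixed) \<subseteq> U"
      using g(1) by (auto simp: U_def fixed_def intro: closed)
  qed (rule fin)
  moreover have "card U \<le> card (N \<times> T)"
  proof (rule card_inj_on_le)
    define h where "h = inv_into U (norm_pow k)"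
    have h: "h n \<in> U" "norm_pow k (h n) = n" if "n \<in> N" for n
      using that unfolding h_def N_def by (auto intro: inv_into_into f_inv_into_f)
    \<comment> \<open>Dividing \<open>m\<close> by a chosen element of the same norm leaves an
      element of norm one, hence a value of \<open>coboundary\<close>.\<close>
    let ?f = "\<lambda>m. (norm_pow k m, m * inverse (h (norm_pow k m)))"
    show "inj_on ?f U"
    proof (rule inj_onI)
      fix m m' assume mm: "m \<in> U" "m' \<in> U" "?f m = ?f m'"
      have "h (norm_pow k m) \<noteq> 0" using h(1)[of "norm_pow k m"] mm by (auto simp: N_def U_def)
      then show "m = m'" using mm by auto
    qed
    show "?f ` U \<subseteq> N \<times> T"
    proof safe
      fix m assume m: "m \<in> U"
      show n: "norm_pow k m \<in> N" using m by (simp add: N_def)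
      define q where "q = m * inverse (h (norm_pow k m))"
      have hU: "h (norm_pow k m) \<in> M" "h (norm_pow k m) \<noteq> 0" using h(1)[OF n] by (auto simp: U_def)
      then have q: "q \<in> M - {0}" using m by (auto simp: q_def U_def intro: closed inverse_mem)
      have "q * h (norm_pow k m) = m" using hU by (simp add: q_def mult.assoc)
      then have "norm_pow k q * norm_pow k m = norm_pow k m"
        using norm_pow_mult[of q "h (norm_pow k m)" k] h(2)[OF n] q hU by auto
      then have "norm_pow k q = 1" using norm_pow_nonzero[of m k] m by (simp add: U_def)
      then show "m * inverse (h (norm_pow k m)) \<in> T"
        using norm_one_imp_coboundary[OF q] by (simp add: T_def U_def q_def)
    qed
  qed (use fin in auto)
  ultimately have "card T * card fixed \<le> card T * card N"
    unfolding card_cartesian_product by (simp only: mult.commute[of "card N"])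
  moreover have "card T > 0" using fin closed(2) by (auto simp: card_gt_0_iff T_def U_def)
  ultimately have "card fixed \<le> card N" by simp
  moreover have "N \<subseteq> fixed" using norm_in_fixed by (auto simp: N_def U_def)
  ultimately have "N = fixed" using fin by (intro card_seteq)
  then have "c \<in> norm_pow k ` (M - {0})" using assms by (simp only: N_def U_def)
  then show ?thesis by blast
qed

text \<open>After multiplying \<open>x\<close> by an element of \<open>M\<close> of norm \<open>inverse (x ^ k)\<close> we have \<open>x ^ k = 1\<close>, and the
  geometric sum is a relation between the independent powers of \<open>x\<close>.\<close>

lemma k_eq_1: "k = 1"
proof (rule ccontr)
  assume "k \<noteq> 1"
  have c: "x ^ k \<noteq> 0" using x_nonzero by simp
  have "inverse (x ^ k) \<in> fixed"
  proof -
    have "x * inverse (x ^ k) = inverse (x ^ k) * x"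
      unfolding power_inverse[symmetric] using x_nonzero by (intro commuting_power_right) simp
    then show ?thesis using c inverse_mem[OF xk_mem] by (simp add: fixed_def)
  qed
  then obtain m where m: "m \<in> M" "m \<noteq> 0" "norm_pow k m = inverse (x ^ k)"
    using norm_surjective by blast
  have "(m * x) ^ k = 1" using c by (simp add: power_eq_norm_pow m(3))
  moreover have "m * x \<noteq> 1"
  proof
    assume "m * x = 1"
    then have "x = inverse m" using inverse_unique by metis
    then have "x \<in> M" using m inverse_mem by simp
    then show False using distinct[of 1] comm a_mem \<open>k \<noteq> 1\<close> k_pos by simp
  qed
  ultimately have "(\<Sum>i<k. (m * x) ^ i) = 0" by (rule geometric_zero)
  then have "(\<Sum>i<k. norm_pow i m * x ^ i) = 0" by (simp only: power_eq_norm_pow)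
  then have "(\<Sum>i<k. norm_pow i m * x ^ i * z * 1) = 0" for z
    by (simp add: sum_distrib_right[symmetric])
  then have "\<forall>i\<in>{..<k}. norm_pow i m = 0"
    using m by (intro powers_independent[of _ _ "\<lambda>i. 1"]) (auto intro: norm_pow_closed)
  then show False using k_pos norm_pow_0[of m] by force
qed

end

text \<open>An eigenvector \<open>x\<close> with \<open>x * a = a ^ j * x\<close> normalizes the
  ring generated by \<open>a\<close> and \<open>x ^ k\<close>, where \<open>k\<close> is the first
  positive exponent for which \<open>x ^ k\<close> commutes with \<open>a\<close>. Torsion makes
  this ring a finite field.\<close>

theorem torsion_division_ring_commutative:
  fixes a y :: "'a::division_ring"
  assumes p: "p > 0" "of_nat p = (0::'a)"
    and torsion: "\<And>x::'a. x \<noteq> 0 \<Longrightarrow> \<exists>n>0. x ^ n = 1"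
  shows "a * y = y * a"
proof (rule ccontr)
  assume ay: "a * y \<noteq> y * a"
  then have a0: "a \<noteq> 0" by auto
  define n where "n = (LEAST n. n > 0 \<and> a ^ n = 1)"
  have n: "n > 0" "a ^ n = 1" using LeastI_ex[OF torsion[OF a0]] by (auto simp: n_def)
  have least: "a ^ i \<noteq> 1" if "0 < i" "i < n" for i
    using not_less_Least[of i "\<lambda>n. n > 0 \<and> a ^ n = 1"] that by (auto simp: n_def)
  have "finite (ring_gen {a, 1})"
    by (rule finite_ring_gen_two_commuting[OF _ n _ _ p, of 1 1]) auto
  then have "of_nat n \<noteq> (0::'a)"
    by (rule of_nat_order_nonzero[OF subring_set_ring_gen _ _ n least]) (auto intro: ring_gen.gen)
  then obtain x j where x: "x \<noteq> 0" "x * a = a ^ j * x" "a ^ j \<noteq> a"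
    using noncommuting_eigenvector[OF n least] ay by metis
  define k where "k = (LEAST k. k > 0 \<and> x ^ k * a = a * x ^ k)"
  have "\<exists>k>0. x ^ k * a = a * x ^ k" using torsion[OF x(1)] by force
  from LeastI_ex[OF this] have k: "k > 0" "x ^ k * a = a * x ^ k" by (auto simp: k_def)
  have kleast: "x ^ i * a \<noteq> a * x ^ i" if "0 < i" "i < k" for i
    using not_less_Least[of i "\<lambda>k. k > 0 \<and> x ^ k * a = a * x ^ k"] that by (auto simp: k_def)
  define M where "M = ring_gen {a, x ^ k}"
  have sub: "subring_set M" unfolding M_def by (rule subring_set_ring_gen)
  have aM: "a \<in> M" and xkM: "x ^ k \<in> M" by (auto simp: M_def intro: ring_gen.gen)
  obtain l where l: "l > 0" "(x ^ k) ^ l = 1" using torsion[of "x ^ k"] x(1) by auto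
  interpret cyclic_normalizer M x a k
  proof
    show "finite M" unfolding M_def
      by (rule finite_ring_gen_two_commuting[OF k(2)[symmetric] n l p])
    show "u * v = v * u" if "u \<in> M" "v \<in> M" for u v
      using that k(2) unfolding M_def by (rule_tac ring_gen_commute[of "{a, x ^ k}"]) auto
    show "inverse u \<in> M" if u: "u \<in> M" for u
    proof (cases "u = 0")
      case False
      then show ?thesis using torsion[of u] torsion_inverse_in_subring[OF sub u] by blast
    qed (use u in simp)
    show "x * u * inverse x \<in> M" if "u \<in> M" for u
      using that unfolding M_def
    proof induction
      case (gen u)
      have "x * a * inverse x = a ^ j" using x by (simp add: mult.assoc)
      moreover have "x * x ^ k * inverse x = x ^ k"
        using x(1) by (simp add: power_commutes[symmetric] mult.assoc)
      ultimately show ?case using gen aM xkM subring_setD(7)[OF sub] unfolding M_def[symmetric] by auto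
    next
      case one
      then show ?case using x(1) by (simp add: ring_gen.one)
    next
      case (diff u v)
      then show ?case by (simp add: right_diff_distrib left_diff_distrib ring_gen.diff)
    next
      case (mult u v)
      have "x * (u * v) * inverse x = (x * u * inverse x) * (x * v * inverse x)"
        using x(1) by (simp add: mult.assoc) (simp flip: mult.assoc)
      then show ?case using mult by (simp add: ring_gen.mult)
    qed
  qed (use sub aM xkM x(1) k kleast in auto)
  \<comment> \<open>With \<open>k = 1\<close>, \<open>x\<close> commutes with \<open>a\<close>, so
    \<open>a ^ j * x = a * x\<close> and \<open>a ^ j = a\<close>, contrary to the choice of
    \<open>x\<close>.\<close>
  show False using k_eq_1 k(2) x by simp
qed

subsection \<open>Division rings algebraic over their center\<close>

text \<open>Take a spanning set of least size among those containing \<open>1\<close>. A nonzero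
  coefficient at some \<open>b0 \<noteq> 1\<close> in a relation would allow \<open>b0\<close> to be
  dropped; what then remains of the relation is \<open>c 1 = 0\<close>.\<close>

lemma independent_spanning_set_containing_one:
  fixes K :: "'a::division_ring set"
  assumes Z: "commutative_subfield Z" and K: "1 \<in> K" and fd: "fin_dim_over Z K"
  obtains B where "finite B" "B \<subseteq> K" "1 \<in> B" "K \<subseteq> span_over Z B"
    and "\<And>c. \<forall>b\<in>B. c b \<in> Z \<Longrightarrow> (\<Sum>b\<in>B. c b * b) = 0 \<Longrightarrow> \<forall>b\<in>B. c b = 0"
proof -
  have Zs: "subring_set Z" and Zinv: "\<And>x. x \<in> Z \<Longrightarrow> inverse x \<in> Z"
    using Z by (auto simp: commutative_subfield_def)
  note ZD = subring_setD[OF Zs]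
  define P where "P B \<longleftrightarrow> finite B \<and> B \<subseteq> K \<and> 1 \<in> B \<and> K \<subseteq> span_over Z B" for B
  obtain B0 where B0: "finite B0" "B0 \<subseteq> K"
    and "\<forall>x\<in>K. \<exists>c. (\<forall>b\<in>B0. c b \<in> Z) \<and> x = (\<Sum>b\<in>B0. c b * b)"
    using fd unfolding fin_dim_over_def by blast
  then have B0_span: "K \<subseteq> span_over Z B0" by (auto simp: span_over_def)
  have "span_over Z B0 \<subseteq> span_over Z (insert 1 B0)"
    using B0 by (intro span_over_least span_over_zero span_over_add span_over_scaled_base ZD) auto
  then have "P (insert 1 B0)" using B0 B0_span K by (auto simp: P_def)
  then obtain B where B: "P B" and min: "\<And>C. P C \<Longrightarrow> card B \<le> card C"
    using ex_has_least_nat[of P _ card] by blast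
  have fin: "finite B" using B by (simp add: P_def)
  have indep: "\<forall>b\<in>B. c b = 0" if c: "\<forall>b\<in>B. c b \<in> Z" and sum0: "(\<Sum>b\<in>B. c b * b) = 0" for c
  proof -
    have other: "c b0 = 0" if b0: "b0 \<in> B" "b0 \<noteq> 1" for b0
    proof (rule ccontr)
      assume nz: "c b0 \<noteq> 0"
      define C where "C = B - {b0}"
      have C: "finite C" using fin by (simp add: C_def)
      have "c b0 * b0 + (\<Sum>b\<in>C. c b * b) = 0"
        using sum0 sum.remove[OF fin b0(1), of "\<lambda>b. c b * b"] by (simp add: C_def)
      then have "c b0 * b0 = - (\<Sum>b\<in>C. c b * b)" by (simp add: eq_neg_iff_add_eq_0)
      then have "inverse (c b0) * (c b0 * b0) = (\<Sum>b\<in>C. - (inverse (c b0) * c b) * b)"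
        by (simp add: sum_distrib_left sum_negf mult.assoc)
      then have b0_eq: "b0 = (\<Sum>b\<in>C. - (inverse (c b0) * c b) * b)"
        using nz by (simp flip: mult.assoc)
      have b0_span: "b0 \<in> span_over Z C"
        by (subst b0_eq, intro span_over_sum[OF Zs] span_over_scaled_base C ZD Zinv)
          (use c b0 in \<open>auto simp: C_def\<close>)
      have "span_over Z B \<subseteq> span_over Z C"
      proof (rule span_over_least)
        fix d b assume "d \<in> Z" "b \<in> B"
        then show "d * b \<in> span_over Z C"
          using b0_span C span_over_scaled_base[OF C ZD(1), of b d] span_over_scale[OF ZD(4), of d b0 C]
          by (cases "b = b0") (auto simp: C_def)
      qed (auto intro: span_over_zero span_over_add ZD)
      then have "P C" using B b0 by (auto simp: P_def C_def)
      then show False using min[of C] card_Diff1_less[OF fin b0(1)] by (simp add: C_def)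
    qed
    have "(\<Sum>b\<in>B. c b * b) = (\<Sum>b\<in>B. if b = 1 then c 1 else 0)"
      by (rule sum.cong) (auto simp: other)
    then have "c 1 = 0" using sum0 fin B by (simp add: P_def)
    then show ?thesis using other by auto
  qed
  show ?thesis by (rule that[of B]) (use B indep in \<open>auto simp: P_def\<close>)
qed

text \<open>An Artin--Tate argument. Since the basis over the center contains \<open>1\<close>, comparing the coefficients
  of \<open>1\<close> replaces the usual appeal to noetherianity.\<close>

lemma center_of_finitely_generated:
  fixes S :: "'a::division_ring set"
  assumes S: "finite S" and inv: "\<And>x. x \<in> ring_gen S \<Longrightarrow> inverse x \<in> ring_gen S"
    and fd: "fin_dim_over (center_of (ring_gen S)) (ring_gen S)"
  shows "\<exists>T. finite T \<and> ring_gen T = center_of (ring_gen S)"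
proof -
  define K where "K = ring_gen S"
  define Z where "Z = center_of K"
  have K: "subring_set K" unfolding K_def by (rule subring_set_ring_gen)
  have Z: "commutative_subfield Z"
    unfolding Z_def by (rule commutative_subfield_center_of[OF K]) (use inv in \<open>simp add: K_def\<close>)
  then have Zs: "subring_set Z" by (simp add: commutative_subfield_def)
  have central: "c * x = x * c" if "c \<in> Z" "x \<in> K" for c x
    using that by (auto simp: Z_def center_of_def)
  have "fin_dim_over Z K" using fd by (simp add: K_def Z_def)
  from independent_spanning_set_containing_one[OF Z subring_setD(2)[OF K] this]
  obtain B where B: "finite B" "B \<subseteq> K" "1 \<in> B" "K \<subseteq> span_over Z B"
    and indep: "\<And>c. \<forall>b\<in>B. c b \<in> Z \<Longrightarrow> (\<Sum>b\<in>B. c b * b) = 0 \<Longrightarrow> \<forall>b\<in>B. c b = 0"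
    by blast
  have "\<forall>x\<in>K. \<exists>c. (\<forall>b\<in>B. c b \<in> Z) \<and> x = (\<Sum>b\<in>B. c b * b)"
    using B(4) by (force simp: span_over_def)
  from bchoice[OF this] obtain \<gamma>
    where \<gamma>': "\<forall>x\<in>K. (\<forall>b\<in>B. \<gamma> x b \<in> Z) \<and> x = (\<Sum>b\<in>B. \<gamma> x b * b)" by blast
  then have \<gamma>: "\<And>x b. x \<in> K \<Longrightarrow> b \<in> B \<Longrightarrow> \<gamma> x b \<in> Z" by blast
  have \<gamma>_sum: "x = (\<Sum>b\<in>B. \<gamma> x b * b)" if "x \<in> K" for x
    using conjunct2[OF bspec[OF \<gamma>' that]] .
  \<comment> \<open>The coordinates of the generators and of the products \<open>b * b'\<close> (the
    structure constants) are what the \<open>Z0\<close>-span of \<open>B\<close> needs to be a ring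
    containing \<open>S\<close>.\<close>
  define X where "X = S \<union> (\<lambda>(b, b'). b * b') ` (B \<times> B)"
  have X: "X \<subseteq> K" using B(2) by (auto simp: X_def K_def intro: ring_gen.gen ring_gen.mult)
  define T where "T = (\<lambda>(x, b). \<gamma> x b) ` (X \<times> B)"
  have T: "finite T" using S B(1) by (auto simp: T_def X_def)
  define Z0 where "Z0 = ring_gen T"
  have Z0: "subring_set Z0" unfolding Z0_def by (rule subring_set_ring_gen)
  note Z0D = subring_setD[OF Z0]
  have Z0Z: "Z0 \<subseteq> Z" unfolding Z0_def
    by (rule ring_gen_least[OF Zs]) (use \<gamma> X in \<open>auto simp: T_def\<close>)
  define W where "W = span_over Z0 B"
  have XW: "x \<in> W" if "x \<in> X" for x
  proof -
    have "x = (\<Sum>b\<in>B. \<gamma> x b * b)" using that X \<gamma>_sum by blast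
    also have "\<dots> \<in> W" unfolding W_def
      using that by (intro span_over_sum[OF Z0] span_over_scaled_base B(1) Z0D)
        (auto simp: Z0_def T_def intro!: ring_gen.gen)
    finally show ?thesis .
  qed
  have "subring_set W" unfolding subring_set_def
  proof (intro conjI ballI)
    show "1 \<in> W" using span_over_scaled_base[OF B(1) Z0D(1) B(3) Z0D(2)] by (simp add: W_def)
    fix x y assume xy: "x \<in> W" "y \<in> W"
    have "x + (- 1) * y \<in> W" using xy unfolding W_def
      by (intro span_over_add span_over_scale Z0D)
    then show "x - y \<in> W" by simp
    have "span_over Z0 B \<subseteq> {u. u * y \<in> W}"
    proof (rule span_over_least)
      fix c b assume cb: "c \<in> Z0" "b \<in> B"
      have "span_over Z0 B \<subseteq> {v. b * v \<in> W}"
      proof (rule span_over_least)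
        fix d b' assume db: "d \<in> Z0" "b' \<in> B"
        have "d * b = b * d" using central db cb B(2) Z0Z by blast
        then have "b * (d * b') = d * (b * b')" by (metis mult.assoc)
        moreover have "b * b' \<in> W" using cb db by (intro XW) (auto simp: X_def)
        ultimately show "d * b' \<in> {v. b * v \<in> W}"
          using span_over_scale[OF Z0D(4) db(1)] by (simp add: W_def)
      qed (auto simp: distrib_left W_def intro: span_over_zero span_over_add Z0D)
      then have "b * y \<in> W" using xy by (auto simp: W_def)
      then show "c * b \<in> {u. u * y \<in> W}"
        using span_over_scale[OF Z0D(4) cb(1)] by (simp add: W_def mult.assoc)
    qed (auto simp: distrib_right W_def intro: span_over_zero span_over_add Z0D)
    then show "x * y \<in> W" using xy by (auto simp: W_def)
  qed
  then have KW: "K \<subseteq> W" unfolding K_def by (rule ring_gen_least) (auto intro: XW simp: X_def)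
  have "Z \<subseteq> Z0"
  proof
    fix z assume z: "z \<in> Z"
    then have "z \<in> W" using KW by (auto simp: Z_def center_of_def)
    then obtain c where c: "\<forall>b\<in>B. c b \<in> Z0" "z = (\<Sum>b\<in>B. c b * b)"
      by (auto simp: W_def span_over_def)
    \<comment> \<open>The difference between the expansion \<open>c\<close> of \<open>z\<close> and
      its trivial expansion \<open>z * 1\<close>.\<close>
    define c' where "c' b = c b - (if b = 1 then z else 0)" for b
    have "(\<Sum>b\<in>B. c' b * b) = (\<Sum>b\<in>B. c b * b) - (\<Sum>b\<in>B. if b = 1 then z else 0)"
      unfolding sum_subtractf[symmetric] by (rule sum.cong) (auto simp: c'_def left_diff_distrib)
    also have "\<dots> = 0" using B(1,3) c(2) by simp
    finally have "\<forall>b\<in>B. c' b = 0"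
      by (rule indep[rotated]) (use c(1) Z0Z z in \<open>auto simp: c'_def intro!: subring_setD[OF Zs]\<close>)
    then have "c 1 = z" using B(3) by (auto simp: c'_def)
    then show "z \<in> Z0" using c(1) B(3) by auto
  qed
  then show ?thesis using T Z0Z unfolding Z0_def Z_def K_def by blast
qed

section \<open>Elements algebraic over the center\<close>

text \<open>Factors \<open>x\<close> are cancelled from the relation until its constant coefficient
  is nonzero; dividing by that coefficient then shows \<open>inverse x\<close> to be a polynomial in
  \<open>x\<close> over the center.\<close>

lemma algebraic_inverse_in_subring:
  fixes x :: "'a::division_ring"
  assumes R: "subring_set R" "center \<subseteq> R" "x \<in> R" and x: "x \<noteq> 0" "algebraic_over center x"
  shows "inverse x \<in> R"
proof -
  note RD = subring_setD[OF R(1)]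
  have "inverse x \<in> R" if "\<forall>i\<le>m. c i \<in> center" "\<exists>i\<le>m. c i \<noteq> 0" "(\<Sum>i\<le>m. c i * x ^ i) = 0"
    for m :: nat and c
    using that
  proof (induction m arbitrary: c)
    case (Suc m)
    define q where "q = (\<Sum>i\<le>m. c (Suc i) * x ^ i)"
    have q: "q \<in> R" unfolding q_def using Suc.prems R by (intro subring_set_sum[OF R(1)] RD) auto
    have "(\<Sum>i\<le>Suc m. c i * x ^ i) = c 0 + q * x"
      unfolding sum.atMost_Suc_shift q_def
      by (simp add: sum_distrib_right mult.assoc power_commutes)
    then have eq: "c 0 + q * x = 0" using Suc.prems by simp
    show ?case
    proof (cases "c 0 = 0")
      case True
      then have "q = 0" using eq x by simp
      moreover have "\<exists>i\<le>m. c (Suc i) \<noteq> 0"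
        using Suc.prems(2) True by (metis Suc_le_mono not0_implies_Suc)
      ultimately show ?thesis using Suc.IH[of "\<lambda>i. c (Suc i)"] Suc.prems(1) by (simp add: q_def)
    next
      case False
      have "- inverse (c 0) * q * x = inverse (c 0) * c 0"
      proof -
        have "q * x = - c 0" using eq by (simp add: eq_neg_iff_add_eq_0 add.commute)
        then show ?thesis by (simp add: mult.assoc)
      qed
      then have "- inverse (c 0) * q * x = 1" using False by simp
      then have "inverse x = - inverse (c 0) * q"
        by (metis inverse_unique inverse_inverse_eq)
      moreover have "inverse (c 0) \<in> R"
        using commutative_subfield_center Suc.prems(1) R(2) by (auto simp: commutative_subfield_def)
      ultimately show ?thesis using q by (simp add: RD)
    qed
  qed simp
  then show ?thesis using x(2) unfolding algebraic_over_def by blast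
qed

text \<open>All powers of \<open>x\<close> lie in the finite span of the powers below the degree of
  the relation, so two of them coincide.\<close>

lemma algebraic_over_finite_center_torsion:
  fixes x :: "'a::division_ring"
  assumes F: "finite (center :: 'a set)" and x: "x \<noteq> 0" "algebraic_over center x"
  shows "\<exists>n>0. x ^ n = 1"
proof -
  have Fs: "subring_set (center :: 'a set)" and Finv: "\<And>c::'a. c \<in> center \<Longrightarrow> inverse c \<in> center"
    using commutative_subfield_center by (auto simp: commutative_subfield_def)
  note FD = subring_setD[OF Fs]
  obtain m c where c: "\<forall>i\<le>m. c i \<in> center" "\<exists>i\<le>m. c i \<noteq> 0" "(\<Sum>i\<le>m. c i * x ^ i) = 0"
    using x(2) unfolding algebraic_over_def by blast
  \<comment> \<open>The top coefficient in \<open>algebraic_over\<close> may vanish;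
    \<open>d\<close> is the true degree, so the relation can be made monic.\<close>
  define d where "d = Max {i. i \<le> m \<and> c i \<noteq> 0}"
  have "d \<in> {i. i \<le> m \<and> c i \<noteq> 0}" unfolding d_def using c(2) by (intro Max_in) auto
  then have d: "d \<le> m" "c d \<noteq> 0" by auto
  have above: "c i = 0" if "d < i" "i \<le> m" for i
    using Max_ge[of "{i. i \<le> m \<and> c i \<noteq> 0}" i] that unfolding d_def[symmetric] by auto
  have "(\<Sum>i\<le>m. c i * x ^ i) = (\<Sum>i\<le>d. c i * x ^ i)"
    using d above by (intro sum.mono_neutral_right) (auto simp: not_le)
  then have "(\<Sum>i<d. c i * x ^ i) + c d * x ^ d = 0"
    using c(3) by (simp add: lessThan_Suc_atMost[symmetric])
  then have "c d * x ^ d = - (\<Sum>i<d. c i * x ^ i)" by (simp add: eq_neg_iff_add_eq_0 add.commute)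
  then have "inverse (c d) * (c d * x ^ d) = (\<Sum>i<d. - (inverse (c d) * c i) * x ^ i)"
    by (simp add: sum_distrib_left sum_negf mult.assoc)
  then have xd: "x ^ d = (\<Sum>i<d. - (inverse (c d) * c i) * x ^ i)"
    using d by (simp flip: mult.assoc)
  define C where "C = (\<lambda>i. x ^ i) ` {..<d}"
  have C: "finite C" by (simp add: C_def)
  define V where "V = span_over center C"
  have xdV: "x ^ d \<in> V" unfolding xd V_def
    by (intro span_over_sum[OF Fs] span_over_scaled_base C FD Finv) (use c d in \<open>auto simp: C_def\<close>)
  have base: "x ^ i \<in> V" if "i < d" for i
    using span_over_scaled_base[OF C FD(1) _ FD(2), of "x ^ i"] that by (auto simp: V_def C_def)
  have "V \<subseteq> {v. x * v \<in> V}" unfolding V_def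
  proof (rule span_over_least)
    fix e v :: 'a assume e: "e \<in> center" and v: "v \<in> C"
    then obtain i where i: "i < d" "v = x ^ i" by (auto simp: C_def)
    then have "x * v \<in> V" using base[of "Suc i"] xdV by (cases "Suc i = d") auto
    then have "e * (x * v) \<in> V" using span_over_scale[OF FD(4) e] by (simp add: V_def)
    moreover have "x * (e * v) = e * (x * v)" using e by (simp add: center_def) (metis mult.assoc)
    ultimately show "e * v \<in> {v. x * v \<in> span_over center C}" by (simp add: V_def)
  qed (auto simp: distrib_left intro: span_over_zero span_over_add FD)
  \<comment> \<open>For \<open>d = 0\<close> the set \<open>C\<close> is empty, and \<open>1\<close>
    is \<open>x ^ d\<close> itself.\<close>
  moreover have "1 \<in> V" using base[of 0] xdV by (cases "d = 0") auto
  ultimately have "x ^ n \<in> V" for n by (induction n) auto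
  then have "range (\<lambda>n. x ^ n) \<subseteq> V" by auto
  moreover have "finite V" unfolding V_def by (rule finite_span_over[OF F C])
  ultimately have "\<not> inj (\<lambda>n::nat. x ^ n)" using finite_subset range_inj_infinite by metis
  then obtain i j :: nat where ij: "i < j" "x ^ i = x ^ j"
    by (metis injI linorder_neqE_nat)
  have "x ^ i * x ^ (j - i) = x ^ j" using ij(1) by (simp flip: power_add)
  also have "\<dots> = x ^ i * 1" using ij(2) by simp
  finally have "x ^ (j - i) = 1" using x by simp
  then show ?thesis using ij by (intro exI[of _ "j - i"]) auto
qed

text \<open>The cardinality of the center vanishes in the ring and serves as the \<open>p\<close> of
  the torsion theorem, prime or not.\<close>

theorem algebraic_over_finite_center_commutative:
  fixes x y :: "'a::division_ring"
  assumes F: "finite (center :: 'a set)" and alg: "\<forall>x::'a. algebraic_over center x"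
  shows "x * y = y * x"
proof -
  have Fs: "subring_set (center :: 'a set)"
    using commutative_subfield_center by (auto simp: commutative_subfield_def)
  have "card (center :: 'a set) > 0" using F subring_setD(1)[OF Fs] by (auto simp: card_gt_0_iff)
  then show ?thesis
    using torsion_division_ring_commutative[OF _ of_nat_card_subring[OF Fs F]]
      algebraic_over_finite_center_torsion[OF F] alg by blast
qed

section \<open>Finitely generated matrix groups\<close>

text \<open>\<open>generate\<close> inverts only the generators themselves, so finitely many inverse
  matrices have to be taken into account.\<close>

lemma generate_GL_entries:
  fixes S :: "('a::division_ring ^'n ^'n) set"
  assumes "A \<in> generate GL S"
  shows "A $ i $ j \<in> ring_gen {B $ k $ l | B k l. B \<in> S \<union> m_inv GL ` S}"
  using assms
proof (induction arbitrary: i j)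
  case one
  then show ?case by (auto simp: GL_def mat_def intro: subring_setD[OF subring_set_ring_gen])
next
  case (incl h)
  then show ?case by (intro ring_gen.gen) blast
next
  case (inv h)
  then show ?case by (intro ring_gen.gen) blast
next
  case (eng h1 h2)
  then show ?case
    by (auto simp: GL_def matrix_matrix_mult_def
        intro!: subring_set_sum[OF subring_set_ring_gen] subring_setD[OF subring_set_ring_gen])
qed

theorem theorem5p9:
  fixes N :: "('a::division_ring ^'n ^'n) set"
  assumes noncomm: "\<exists>x y :: 'a. x * y \<noteq> y * x"
    and alg: "\<forall>x::'a. algebraic_over center x"
    and wlf: "weakly_locally_finite TYPE('a)"
    and sub: "subgroup N GL"
    and scal: "\<forall>\<alpha>\<in>(center :: 'a set). \<alpha> \<noteq> 0 \<longrightarrow> mat \<alpha> \<in> N"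
  shows "\<not> (\<exists>S. finite S \<and> S \<subseteq> N \<and> generate GL S = N)"
proof
  assume "\<exists>S. finite S \<and> S \<subseteq> N \<and> generate GL S = N"
  then obtain S where S: "finite S" "generate GL S = N" by blast
  define E where "E = {B $ k $ l | B k l. B \<in> S \<union> m_inv GL ` S}"
  have "E = (\<lambda>(B, k, l). B $ k $ l) ` ((S \<union> m_inv GL ` S) \<times> UNIV \<times> UNIV)"
    by (auto simp: E_def image_iff) blast+
  then have E: "finite E" using S by simp
  define K where "K = ring_gen E"
  have Ks: "subring_set K" unfolding K_def by (rule subring_set_ring_gen)
  have FK: "center \<subseteq> K"
  proof
    fix \<alpha> :: 'a assume \<alpha>: "\<alpha> \<in> center"
    show "\<alpha> \<in> K"
    proof (cases "\<alpha> = 0")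
      case False
      then have "mat \<alpha> \<in> generate GL S" using scal \<alpha> S by blast
      \<comment> \<open>Any diagonal entry of \<open>mat \<alpha>\<close> is
        \<open>\<alpha>\<close>; \<open>undefined\<close> merely names some index.\<close>
      from generate_GL_entries[OF this, of undefined undefined]
      show ?thesis by (simp add: K_def E_def mat_def)
    qed (simp add: subring_setD[OF Ks])
  qed
  have Kinv: "inverse x \<in> K" if "x \<in> K" for x
    using algebraic_inverse_in_subring[OF Ks FK that] alg that by (cases "x = 0") auto
  \<comment> \<open>Weak local finiteness speaks of the generated division ring; closure under
    inverses identifies it with \<open>K\<close>, which is finitely generated as a ring.\<close>
  have "div_subring_gen E = K"
  proof
    have "x - y \<in> div_subring_gen E" if "x \<in> div_subring_gen E" "y \<in> div_subring_gen E" for x y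
      using div_subring_gen.add[OF that(1) div_subring_gen.neg[OF that(2)]] by simp
    then have "subring_set (div_subring_gen E)"
      by (auto simp: subring_set_def intro: div_subring_gen.intros)
    then show "K \<subseteq> div_subring_gen E"
      unfolding K_def by (rule ring_gen_least) (auto intro: div_subring_gen.gen)
    show "div_subring_gen E \<subseteq> K"
    proof
      fix x assume "x \<in> div_subring_gen E"
      then show "x \<in> K"
        by induction (auto intro: subring_setD[OF Ks] Kinv, simp add: K_def ring_gen.gen)
    qed
  qed
  then have "fin_dim_over (center_of K) K"
    using wlf E unfolding weakly_locally_finite_def by metis
  then obtain T where "finite T" "ring_gen T = center_of K"
    using center_of_finitely_generated[OF E] Kinv unfolding K_def by blast
  then have "finite (center_of K)"
    using finitely_generated_subfield_finite commutative_subfield_center_of[OF Ks Kinv] by blast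
  moreover have "center \<subseteq> center_of K" using FK by (auto simp: center_def center_of_def)
  ultimately have "finite (center :: 'a set)" by (rule finite_subset[rotated])
  then show False using algebraic_over_finite_center_commutative alg noncomm by blast
qed

end
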